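(* Let $n,k,\ell$ be integers with $0\le \ell\le k\le n$ and $n\ge 3k-1$, let $\lambda$ be an integer, let $\mathcal{A}=\mathcal{A}_{n,k,k,\ell}$ be the adjacency matrix of the subset intersection graph $\Gamma(n,k,\ell)$, and let $\mathcal{L}=\mathcal{A}-\lambda\mathcal{I}$, where $\mathcal{I}$ is the $\binom{n}{k}\times\binom{n}{k}$ identity matrix. For each $s=0,1,\dots,k$ let $\mathcal{M}_s$ be the $(k-s+1)\times(k-s+1)$ integer matrix, with rows and columns indexed by $s\le i,j\le k$, with entries $$\mathcal{M}_s(i,j)=-\lambda\,\delta_{i,j}+\binom{j-s}{i-s}\sum_{v=0}^{i}(-1)^{i+v}\binom{i}{v}\binom{k-v}{\ell-v}\binom{n-k-j+v}{k-\ell-j+v},$$ and let $\Delta(\mathcal{M}_s)$ be the multiset of diagonal entries of a diagonal form of $\mathcal{M}_s$. Then $\mathcal{L}$ has a diagonal form whose multiset of diagonal entries is $$\bigcup_{s=0}^{k}\Delta(\mathcal{M}_s)^{\binom{n}{s}-2\binom{n}{s-1}+\binom{n}{s-2}},$$ where the exponent means that each element of $\Delta(\mathcal{M}_s)$ (counted with its own multiplicity) is included with the indicated multiplicity. Equivalently, $$S(\mathcal{L})\cong\bigoplus_{s=0}^{k}S(\mathcal{M}_s)^{\binom{n}{s}-2\binom{n}{s-1}+\binom{n}{s-2}}.$$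
   Context: Binomial convention: $\binom{a}{b}=0$ whenever $b<0$ or $a<b$; $\delta_{i,j}$ is the Kronecker delta. The matrix $\mathcal{A}_{n,k,k,\ell}$ has rows and columns indexed by the $k$-element subsets of $\{1,\dots,n\}$, with $(A,B)$ entry $1$ if $|A\cap B|=\ell$ and $0$ otherwise; it is the adjacency matrix of the subset intersection graph $\Gamma(n,k,\ell)$. A unimodular matrix is a square integer matrix with an integer inverse. A diagonal form of an integer matrix $M$ is a matrix $D$ of the same dimensions as $M$, with $(i,j)$-entry $0$ unless $i=j$, such that $EMF=D$ for some unimodular matrices $E,F$. The Smith group of an $m\times n$ integer matrix $M$ is $S(M)=\mathbb{Z}^n/\mathrm{row}_{\mathbb{Z}}(M)$, where $\mathrm{row}_{\mathbb{Z}}(M)$ is the set of integer linear combinations of the rows of $M$. For an abelian group $G$, $G^m$ is the direct sum of $m$ copies of $G$. *)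

theory Defs
  imports
    "Jordan_Normal_Form.Matrix"
    "HOL-Algebra.Product_Groups"
    "HOL-Library.Multiset"
begin

section \<open>Binomial coefficients with integer arguments\<close>

text \<open>The value is zero when the lower argument is negative or exceeds the upper one.
  Both arguments are integers because differences such as \<open>k - l - j + v\<close>
  can be negative and must not be truncated.\<close>

definition ibinom :: "int \<Rightarrow> int \<Rightarrow> int" where
  "ibinom a b = (if b < 0 \<or> a < b then 0 else int (nat a choose nat b))"


section \<open>Diagonal forms and Smith groups of integer matrices\<close>

text \<open>For integer matrices, \<^const>\<open>invertible_mat\<close> says exactly that the matrix is
  unimodular: it is square and has an inverse with integer entries.\<close>

definition is_diagonal_form :: "int mat \<Rightarrow> int mat \<Rightarrow> bool" where
  "is_diagonal_form M D \<longleftrightarrow>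
     D \<in> carrier_mat (dim_row M) (dim_col M) \<and> diagonal_mat D \<and>
     (\<exists>E F. E \<in> carrier_mat (dim_row M) (dim_row M) \<and> invertible_mat E \<and>
            F \<in> carrier_mat (dim_col M) (dim_col M) \<and> invertible_mat F \<and>
            E * M * F = D)"

text \<open>\<^const>\<open>diag_mat\<close> runs over the row indices, so this is intended for square matrices.\<close>

definition diag_entries :: "int mat \<Rightarrow> int multiset" where
  "diag_entries D = mset (diag_mat D)"

text \<open>The vector \<open>transpose_mat M *\<^sub>v c\<close> is the combination of the rows of \<open>M\<close> with
  coefficients \<open>c\<close>.\<close>

definition row_lattice :: "int mat \<Rightarrow> int vec set" where
  "row_lattice M = {transpose_mat M *\<^sub>v c | c. c \<in> carrier_vec (dim_row M)}"

definition smith_group :: "int mat \<Rightarrow> int vec set monoid" where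
  "smith_group M = monoid_vec TYPE(int) (dim_col M) Mod row_lattice M"

definition group_power :: "('a, 'b) monoid_scheme \<Rightarrow> nat \<Rightarrow> (nat \<Rightarrow> 'a) monoid" where
  "group_power G m = sum_group {..<m} (\<lambda>_. G)"


section \<open>The subset intersection graph and the small matrices\<close>

definition k_subsets :: "nat \<Rightarrow> nat \<Rightarrow> nat set set" where
  "k_subsets n k = {A. A \<subseteq> {1..n} \<and> card A = k}"

text \<open>Matrices are indexed by natural numbers, so the adjacency matrix is formed relative to an
  enumeration \<open>e\<close> of the \<open>k\<close>-subsets, that is, a bijection from \<open>{..<n choose k}\<close> to
  \<open>k_subsets n k\<close>.\<close>

definition subset_adj_mat :: "(nat \<Rightarrow> nat set) \<Rightarrow> nat \<Rightarrow> nat \<Rightarrow> nat \<Rightarrow> int mat" where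
  "subset_adj_mat e n k l =
     mat (n choose k) (n choose k) (\<lambda>(a, b). if card (e a \<inter> e b) = l then 1 else 0)"

definition M_entry :: "nat \<Rightarrow> nat \<Rightarrow> nat \<Rightarrow> int \<Rightarrow> nat \<Rightarrow> nat \<Rightarrow> nat \<Rightarrow> int" where
  "M_entry n k l lam s i j =
     - lam * (if i = j then 1 else 0)
     + ibinom (int j - int s) (int i - int s) *
       (\<Sum>v = 0..i. (-1) ^ (i + v) * ibinom (int i) (int v)
          * ibinom (int k - int v) (int l - int v)
          * ibinom (int n - int k - int j + int v) (int k - int l - int j + int v))"

text \<open>The index range \<open>s \<le> i, j \<le> k\<close> is shifted to start at \<open>0\<close>.\<close>

definition M_mat :: "nat \<Rightarrow> nat \<Rightarrow> nat \<Rightarrow> int \<Rightarrow> nat \<Rightarrow> int mat" where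
  "M_mat n k l lam s =
     mat (k - s + 1) (k - s + 1) (\<lambda>(a, b). M_entry n k l lam s (s + a) (s + b))"

definition M_mult :: "nat \<Rightarrow> nat \<Rightarrow> int" where
  "M_mult n s = ibinom (int n) (int s) - 2 * ibinom (int n) (int s - 1)
                + ibinom (int n) (int s - 2)"

text \<open>Under the standing hypothesis the multiplicities are nonnegative, so turning them into
  natural numbers by \<^const>\<open>nat\<close> loses nothing.\<close>

lemma M_mult_nonneg:
  assumes "3 * k \<le> n + 1" "s \<le> k"
  shows "0 \<le> M_mult n s"
proof (cases s)
  case 0
  then show ?thesis by (simp add: M_mult_def ibinom_def)
next
  case (Suc t)
  have t: "3 * Suc t \<le> n + 1" using assms Suc by simp
  have eq: "Suc t * (n choose Suc t) = (n - t) * (n choose t)"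
    using binomial_absorb_comp[of n t] binomial_absorption[of t n] by simp
  have "Suc t * (2 * (n choose t)) \<le> (n - t) * (n choose t)"
    using mult_le_mono1[of "2 * Suc t" "n - t" "n choose t"] t by (simp add: algebra_simps)
  then have "2 * (n choose t) \<le> n choose Suc t"
    unfolding eq[symmetric] by (metis mult_le_cancel1 zero_less_Suc)
  moreover have "ibinom (int n) (int s) = int (n choose Suc t)"
    "ibinom (int n) (int s - 1) = int (n choose t)" "0 \<le> ibinom (int n) (int s - 2)"
    using Suc t by (auto simp: ibinom_def nat_add_distrib binomial_eq_0)
  ultimately show ?thesis by (simp add: M_mult_def)
qed

end

theory Submission
  imports Defs "Jordan_Normal_Form.Determinant"
begin

text \<open>A function \<open>x\<close> on the \<open>j\<close>-subsets of \<open>{1..n}\<close> gives the function \<open>K \<mapsto> (\<Sum>J \<subseteq> K. x J)\<close> on the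
\<open>k\<close>-subsets. Applying the adjacency matrix to it means counting, for \<open>J\<close> and \<open>K\<close> fixed, the \<open>k\<close>-sets
through \<open>J\<close> that meet \<open>K\<close> in \<open>l\<close> points. This number depends on \<open>|J \<inter> K|\<close> alone, and binomial inversion
writes it as a combination of the binomials \<open>|J \<inter> K| choose u\<close>. The coefficients are the alternating
sums in the matrices \<open>M_mat n k l lam s\<close>, and \<open>|J \<inter> K| choose u\<close> counts the \<open>u\<close>-sets \<open>I \<subseteq> J \<inter> K\<close>. Hence the
matrix acts through the sums of \<open>x\<close> over the supersets of such \<open>I\<close> (\<open>intersection_sum_downsum\<close>). Suppose that
functions \<open>x\<^sub>s, \<dots>, x\<^sub>k\<close> on the \<open>s\<close>-, ..., \<open>k\<close>-sets are such that the sum of \<open>x\<^sub>j\<close> over the supersets of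
a \<open>u\<close>-set \<open>I\<close> is \<open>(j - s choose u - s) * x\<^sub>u I\<close>, and zero for \<open>u < s\<close>. Then the functions on \<open>k\<close>-sets that
they induce are transformed by \<open>L\<close> exactly as \<open>M_mat n k l lam s\<close> prescribes (\<open>binomial_chain_action\<close>).
So it suffices to find an integral basis of the functions on \<open>k\<close>-sets made of such chains, with
\<open>M_mult n s\<close> chains starting at level \<open>s\<close>: then \<open>L\<close> is conjugate, by a unimodular matrix, to a
block-diagonal matrix, from which diagonal forms and Smith groups are read off.

The basis is built on ballot sets. Reading \<open>n, n - 1, \<dots>, 1\<close> as a path that steps down at the elements of
\<open>J\<close> and up elsewhere, \<open>J\<close> is ballot if the path stays nonnegative. There are
\<open>(n choose j) - (n choose (j - 1))\<close> ballot \<open>j\<close>-sets, and every integer function on \<open>k\<close>-sets is induced from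
ballot sets of size at most \<open>k\<close> (\<open>ballot_interpolation\<close>); by counting, these form an integral basis.
Subsets of ballot sets are ballot, so summing over supersets preserves the modules \<open>X\<^sub>j\<close> of functions on
ballot \<open>j\<close>-sets, and what remains is to split \<open>X\<^sub>0, \<dots>, X\<^sub>k\<close> into chains, one level at a time.
Every chain is prolonged by one level, and a basis of the functions in the new level whose superset sums at all lower
levels vanish is added as the starting points of new chains. The result spans the level
because the superset sums of an arbitrary function in \<open>X\<^sub>j\<close>, being integral at each lower level, force the
coefficients to be divisible by exactly the factors that the prolonged chains carry
(\<open>binomial_chains_extend\<close>). Counting dimensions then gives second differences of binomial coefficients
as the numbers of new chains, which are the multiplicities \<open>M_mult n s\<close>.

Prolonging a chain is an integral solvability question: given \<open>b\<close> in \<open>X\<^sub>t\<close>, is there an \<open>x\<close> in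
\<open>X\<^sub>t\<^sub>+\<^sub>1\<close> whose sum over the supersets of each \<open>A\<close> with at most \<open>t\<close> elements is the corresponding sum of
\<open>b\<close> divided by \<open>t + 1 - |A|\<close>? The obvious divisibility conditions suffice (\<open>ballot_lift\<close>). The proof
removes the top element \<open>n\<close>. If the path steps up there, the rest is a path with starting height \<open>c\<close>
one larger; if it steps down, \<open>c\<close> and \<open>t\<close> both drop by one. In either case the inequality
\<open>n + c \<ge> 3 * t + 2\<close> persists. When \<open>n\<close> has fallen to \<open>2 * t + 1\<close>, it gives
\<open>c \<ge> t + 1\<close>, all sets of size at most \<open>t + 1\<close> are ballot, and an explicit formula solves the problem. With
\<open>c = 0\<close> and \<open>t + 1 \<le> k\<close> this is where \<open>n \<ge> 3 * k - 1\<close> enters.\<close>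

section \<open>Ballot sets\<close>

text \<open>The subsets of \<open>{1..n}\<close> whose path, started at height \<open>c\<close>, reading \<open>n\<close> first and stepping down at
elements of the set, never becomes negative. Keeping the starting height as a parameter makes removal of
the top element stay inside the definition; at height \<open>0\<close> the top element is excluded.\<close>

fun ballot :: "nat \<Rightarrow> nat \<Rightarrow> nat set set" where
  "ballot 0 c = {{}}"
| "ballot (Suc n) 0 = ballot n 1"
| "ballot (Suc n) (Suc c) = ballot n (Suc (Suc c)) \<union> insert (Suc n) ` ballot n c"

definition layer :: "nat set set \<Rightarrow> nat \<Rightarrow> (nat set \<Rightarrow> int) set" where
  "layer F j = {v. \<forall>A. v A \<noteq> 0 \<longrightarrow> A \<in> F \<and> card A = j}"

section \<open>Sums over supersets and over subsets\<close>

text \<open>For \<open>v\<close> supported on \<open>j\<close>-sets and \<open>A\<close> an \<open>i\<close>-set this is the divided power of order \<open>j - i\<close> of the lowering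
operator applied to \<open>v\<close>. One function of \<open>A\<close> thus carries all divided powers, and no factorials occur.\<close>

definition upsum :: "nat \<Rightarrow> (nat set \<Rightarrow> int) \<Rightarrow> nat set \<Rightarrow> int" where
  "upsum n v A = (\<Sum>T | A \<subseteq> T \<and> T \<subseteq> {1..n}. v T)"

lemma ballot_subset: "J \<in> ballot n c \<Longrightarrow> J \<subseteq> {1..n}"
proof (induction n c arbitrary: J rule: ballot.induct)
  case (2 n)
  then show ?case by fastforce
next
  case (3 n c)
  then show ?case by fastforce
qed auto

lemma finite_ballot [simp]: "finite (ballot n c)"
  using ballot_subset by (intro finite_subset[of "ballot n c" "Pow {1..n}"]) auto

lemma Suc_notin_ballot: "J \<in> ballot n c \<Longrightarrow> Suc n \<notin> J"
  using ballot_subset by fastforce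

lemma ballot_mono: "J \<in> ballot n c \<Longrightarrow> J \<in> ballot n (Suc c)"
proof (induction n c arbitrary: J rule: ballot.induct)
  case (2 n)
  then show ?case using "2.IH" by (simp add: numeral_2_eq_2)
qed auto

text \<open>Deleting an element turns a step down into a step up, which raises the rest of the path. In particular
ballot sets form a simplicial complex, and sums over supersets of functions on ballot sets live on ballot
sets again.\<close>

lemma ballot_down: "J \<in> ballot n c \<Longrightarrow> J' \<subseteq> J \<Longrightarrow> J' \<in> ballot n c"
proof (induction n c arbitrary: J J' rule: ballot.induct)
  case (3 n c)
  from "3.prems" consider "J \<in> ballot n (Suc (Suc c))" | I where "I \<in> ballot n c" "J = insert (Suc n) I"
    by auto
  then show ?case
  proof cases
    case 1
    then show ?thesis using "3.IH"(1)[of J J'] "3.prems" by simp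
  next
    case 2
    then have I: "J' - {Suc n} \<in> ballot n c" using "3.IH"(2)[of I "J' - {Suc n}"] "3.prems" by auto
    show ?thesis
    proof (cases "Suc n \<in> J'")
      case True
      then have "J' = insert (Suc n) (J' - {Suc n})" by auto
      then show ?thesis using I by (metis UnI2 ballot.simps(3) imageI)
    next
      case False
      then have "J' \<in> ballot n c" using I by simp
      then show ?thesis using ballot_mono by simp
    qed
  qed
qed auto

text \<open>A path with at most \<open>c\<close> steps down from height \<open>c\<close> cannot become negative.\<close>

lemma ballot_full: "J \<subseteq> {1..n} \<Longrightarrow> card J \<le> c \<Longrightarrow> J \<in> ballot n c"
proof (induction n c arbitrary: J rule: ballot.induct)
  case (2 n)
  have "finite J" using "2.prems"(1) finite_subset by blast
  then have "J = {}" using "2.prems" by simp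
  then show ?case using "2.IH"[of J] by simp
next
  case (3 n c)
  have fin: "finite J" using "3.prems"(1) finite_subset by blast
  show ?case
  proof (cases "Suc n \<in> J")
    case True
    have "J - {Suc n} \<subseteq> {1..n}" using "3.prems"(1) by fastforce
    moreover have "card (J - {Suc n}) \<le> c" using "3.prems"(2) fin True by simp
    ultimately have "J - {Suc n} \<in> ballot n c" using "3.IH"(2) by simp
    moreover have "J = insert (Suc n) (J - {Suc n})" using True by auto
    ultimately show ?thesis by (metis UnI2 ballot.simps(3) imageI)
  next
    case False
    then have "J \<subseteq> {1..n}" using "3.prems"(1) by (auto simp: le_Suc_eq subset_iff)
    then show ?thesis using "3.IH"(1)[of J] "3.prems" by simp
  qed
qed auto

text \<open>The reflection principle. Both binomial coefficients obey Pascal's rule along the recursion of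
\<^const>\<open>ballot\<close>. The assumption says that the path ends at height at least \<open>-1\<close>; at height \<open>-1\<close> there is no
ballot set, and the two binomial coefficients coincide by symmetry.\<close>

lemma ballot_card:
  assumes "2 * j \<le> n + c + 1"
  shows "card {J \<in> ballot n c. card J = j} + (if c < j then n choose (j - Suc c) else 0) = n choose j"
  using assms
proof (induction n c arbitrary: j rule: ballot.induct)
  case (1 c)
  have "{J \<in> ballot 0 c. card J = j} = (if j = 0 then {{}} else {})" by auto
  then show ?case using 1 by (auto simp: binomial_eq_0)
next
  case (2 n)
  show ?case
  proof (cases "j \<le> 1")
    case True
    then consider "j = 0" | "j = 1" by linarith
    then show ?thesis using "2.IH"[of j] "2.prems" by cases auto
  next
    case False
    then obtain i where "j = Suc (Suc i)" by (metis One_nat_def Suc_le_eq not_less not0_implies_Suc Suc_leI le_SucI le_zero_eq not_less_eq_eq)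
    then show ?thesis using "2.IH"[of j] "2.prems" by simp
  qed
next
  case (3 n c)
  let ?A = "{J \<in> ballot n (Suc (Suc c)). card J = j}"
  let ?B = "{J \<in> insert (Suc n) ` ballot n c. card J = j}"
  have "{J \<in> ballot (Suc n) (Suc c). card J = j} = ?A \<union> ?B" by auto
  moreover have "?A \<inter> ?B = {}" using Suc_notin_ballot by auto
  ultimately have split: "card {J \<in> ballot (Suc n) (Suc c). card J = j} = card ?A + card ?B"
    by (simp add: card_Un_disjoint)
  have fin: "finite I" if "I \<in> ballot n c" for I
    using ballot_subset[OF that] finite_subset by blast
  show ?case
  proof (cases j)
    case 0
    have "?B = {}" using 0 fin by (auto simp: card_eq_0_iff)
    then show ?thesis using 0 split "3.IH"(1)[of 0] "3.prems" by simp
  next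
    case (Suc i)
    have "?B = insert (Suc n) ` {J \<in> ballot n c. card J = i}"
      using Suc fin Suc_notin_ballot by (auto simp: card_insert_if)
    moreover have "inj_on (insert (Suc n)) {J \<in> ballot n c. card J = i}"
      using Suc_notin_ballot by (intro inj_onI) (metis (no_types, lifting) insert_ident mem_Collect_eq)
    ultimately have B: "card ?B = card {J \<in> ballot n c. card J = i}"
      by (simp add: card_image)
    have 1: "card ?A + (if Suc (Suc c) < j then n choose (j - Suc (Suc (Suc c))) else 0) = n choose j"
      using "3.IH"(1)[of j] "3.prems" by simp
    have 2: "card {J \<in> ballot n c. card J = i} + (if c < i then n choose (i - Suc c) else 0) = n choose i"
      using "3.IH"(2)[of i] "3.prems" Suc by simp
    have 3: "(if Suc c < j then Suc n choose (j - Suc (Suc c)) else 0)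
      = (if Suc (Suc c) < j then n choose (j - Suc (Suc (Suc c))) else 0) + (if c < i then n choose (i - Suc c) else 0)"
    proof (cases "c < i")
      case True
      then obtain m where "i = c + Suc m" using less_iff_Suc_add by auto
      then show ?thesis using Suc by (cases m) auto
    qed (use Suc in auto)
    show ?thesis using split B 1 2 3 Suc by simp
  qed
qed

lemma sum_Pow_insert:
  fixes f :: "'a set \<Rightarrow> int"
  assumes "finite Z" "a \<notin> Z"
  shows "sum f (Pow (insert a Z)) = sum f (Pow Z) + (\<Sum>S\<in>Pow Z. f (insert a S))"
proof -
  have "inj_on (insert a) (Pow Z)" using assms(2) by (auto simp: inj_on_def)
  moreover have "Pow Z \<inter> insert a ` Pow Z = {}" using assms(2) by auto
  ultimately show ?thesis using assms(1)
    by (simp add: Pow_insert sum.union_disjoint sum.reindex)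
qed

lemma sum_Pow_alternating:
  "finite Z \<Longrightarrow> (\<Sum>S\<in>Pow Z. (-1) ^ card S) = (if Z = {} then 1 else 0 :: int)"
proof (induction Z rule: finite_induct)
  case (insert a Z)
  have "(\<Sum>S\<in>Pow Z. (-1) ^ card (insert a S)) = (\<Sum>S\<in>Pow Z. - ((-1) ^ card S) :: int)"
    using insert by (intro sum.cong) (auto simp: card_insert_if finite_subset)
  then show ?case using insert by (simp add: sum_Pow_insert sum_negf)
qed simp

lemma upsum_Suc_in:
  assumes "Suc n \<in> A"
  shows "upsum (Suc n) v A = upsum n (\<lambda>T. v (insert (Suc n) T)) (A - {Suc n})"
  unfolding upsum_def
  by (rule sum.reindex_bij_witness[where i = "insert (Suc n)" and j = "\<lambda>T. T - {Suc n}"])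
    (use assms in \<open>auto simp: insert_absorb subset_iff le_Suc_eq\<close>)

lemma upsum_Suc_notin:
  assumes "Suc n \<notin> A"
  shows "upsum (Suc n) v A = upsum n v A + upsum n (\<lambda>T. v (insert (Suc n) T)) A"
proof -
  have "{T. A \<subseteq> T \<and> T \<subseteq> {1..Suc n}} = {T. A \<subseteq> T \<and> T \<subseteq> {1..n}} \<union> {T. insert (Suc n) A \<subseteq> T \<and> T \<subseteq> {1..Suc n}}"
    (is "_ = ?X \<union> ?Y") using assms by (auto simp: le_Suc_eq subset_iff)
  moreover have "?X \<inter> ?Y = {}" by auto
  moreover have "finite ?X" "finite ?Y" by (auto intro: finite_subset[of _ "Pow {1..Suc n}"])
  ultimately have "upsum (Suc n) v A = upsum n v A + upsum (Suc n) v (insert (Suc n) A)"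
    unfolding upsum_def by (simp add: sum.union_disjoint)
  then show ?thesis using upsum_Suc_in[of n "insert (Suc n) A" v] assms by simp
qed

lemma upsum_cong:
  "(\<And>T. A \<subseteq> T \<Longrightarrow> T \<subseteq> {1..n} \<Longrightarrow> v T = w T) \<Longrightarrow> upsum n v A = upsum n w A"
  unfolding upsum_def by (intro sum.cong) auto

lemma upsum_diff: "upsum n (\<lambda>T. v T - w T) A = upsum n v A - upsum n w A"
  unfolding upsum_def by (rule sum_subtractf)

lemma upsum_big:
  assumes "v \<in> layer F j" "j < card A"
  shows "upsum n v A = 0"
  unfolding upsum_def
proof (rule sum.neutral, safe)
  fix T assume "A \<subseteq> T" "T \<subseteq> {1..n}"
  then have "card A \<le> card T" by (meson card_mono finite_atLeastAtMost finite_subset)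
  then show "v T = 0" using assms unfolding layer_def by force
qed

lemma upsum_same:
  assumes "v \<in> layer F j" "card A = j" "A \<subseteq> {1..n}"
  shows "upsum n v A = v A"
proof -
  have "v T = 0" if "A \<subseteq> T" "T \<subseteq> {1..n}" "T \<noteq> A" for T
  proof -
    have "finite T" using that(2) finite_subset by blast
    then have "card A < card T" using that by (intro psubset_card_mono) auto
    then show ?thesis using assms unfolding layer_def by force
  qed
  then have "upsum n v A = (\<Sum>T\<in>{A}. v T)" unfolding upsum_def using assms(3)
    by (intro sum.mono_neutral_right) (auto intro: finite_subset[of _ "Pow {1..n}"])
  then show ?thesis by simp
qed

text \<open>A \<open>(t + 1)\<close>-set above \<open>A\<close> contains \<open>t + 1 - |A|\<close> of the \<open>t\<close>-sets above \<open>A\<close>.\<close>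

lemma upsum_layer:
  assumes v: "v \<in> layer F (Suc t)" and "A \<subseteq> {1..n}" "card A \<le> t"
  shows "(\<Sum>I | A \<subseteq> I \<and> I \<subseteq> {1..n} \<and> card I = t. upsum n v I) = int (Suc t - card A) * upsum n v A"
proof -
  let ?I = "{I. A \<subseteq> I \<and> I \<subseteq> {1..n} \<and> card I = t}"
  let ?T = "{T. A \<subseteq> T \<and> T \<subseteq> {1..n}}"
  have fin: "finite ?I" "finite ?T" by (auto intro: finite_subset[of _ "Pow {1..n}"])
  have finA: "finite A" using assms(2) finite_subset by blast
  have "upsum n v I = (\<Sum>T\<in>?T. if I \<subseteq> T then v T else 0)" if "I \<in> ?I" for I
    unfolding upsum_def using that fin(2)
    by (subst sum.inter_filter[symmetric]) (auto intro!: sum.cong)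
  then have "(\<Sum>I\<in>?I. upsum n v I) = (\<Sum>I\<in>?I. \<Sum>T\<in>?T. if I \<subseteq> T then v T else 0)"
    by simp
  also have "\<dots> = (\<Sum>T\<in>?T. \<Sum>I\<in>?I. if I \<subseteq> T then v T else 0)" by (rule sum.swap)
  also have "\<dots> = (\<Sum>T\<in>?T. int (Suc t - card A) * v T)"
  proof (rule sum.cong[OF refl])
    fix T assume T: "T \<in> ?T"
    then have finT: "finite T" using finite_subset by blast
    have eq: "(\<Sum>I\<in>?I. if I \<subseteq> T then v T else 0) = int (card {I \<in> ?I. I \<subseteq> T}) * v T"
      using fin(1) by (subst sum.inter_filter[symmetric]) auto
    show "(\<Sum>I\<in>?I. if I \<subseteq> T then v T else 0) = int (Suc t - card A) * v T"
    proof (cases "v T = 0")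
      case False
      then have cT: "card T = Suc t" using v unfolding layer_def by auto
      have "{I \<in> ?I. I \<subseteq> T} = (\<lambda>a. T - {a}) ` (T - A)"
      proof (intro equalityI subsetI)
        fix I assume I: "I \<in> {I \<in> ?I. I \<subseteq> T}"
        then have "card (T - I) = 1" using cT finT
          by (subst card_Diff_subset) (auto intro: finite_subset)
        then obtain a where a: "T - I = {a}" by (rule card_1_singletonE)
        then have "I = T - {a}" "a \<in> T - A" using I by auto
        then show "I \<in> (\<lambda>a. T - {a}) ` (T - A)" by blast
      next
        fix I assume "I \<in> (\<lambda>a. T - {a}) ` (T - A)"
        then show "I \<in> {I \<in> ?I. I \<subseteq> T}" using T cT finT by auto
      qed
      moreover have "inj_on (\<lambda>a. T - {a}) (T - A)" by (auto simp: inj_on_def)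
      ultimately have "card {I \<in> ?I. I \<subseteq> T} = card (T - A)" by (simp add: card_image)
      also have "\<dots> = Suc t - card A" using cT T finA by (subst card_Diff_subset) auto
      finally show ?thesis using eq by simp
    qed (use eq in simp)
  qed
  finally show ?thesis unfolding upsum_def by (simp add: sum_distrib_left)
qed

section \<open>Integral solvability on ballot sets\<close>

text \<open>On \<open>2 * t + 1\<close> points the passage from \<open>(t + 1)\<close>-sets to \<open>t\<close>-sets is square, and its inverse is a sum over
the sets \<open>S\<close> disjoint from \<open>J\<close>. A \<open>t\<close>-set \<open>A\<close> misses \<open>t + 1\<close> points, so among the sets \<open>J\<close> obtained
from \<open>A\<close> by adding one point, exactly \<open>t + 1 - |S|\<close> are disjoint from a given \<open>S\<close> disjoint from \<open>A\<close>. This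
cancels the denominator, and inclusion-exclusion leaves \<open>b A\<close>.\<close>

lemma ballot_lift_square:
  assumes n: "n = 2 * t + 1" and c: "t < c"
    and b: "b \<in> layer (ballot n c) t"
    and dvd: "\<And>A. A \<subseteq> {1..n} \<Longrightarrow> card A \<le> t \<Longrightarrow> int (Suc t - card A) dvd upsum n b A"
  shows "\<exists>x \<in> layer (ballot n c) (Suc t). \<forall>A \<subseteq> {1..n}. card A \<le> t \<longrightarrow>
           int (Suc t - card A) * upsum n x A = upsum n b A"
proof -
  define g where "g S = (-1) ^ card S * (upsum n b S div int (Suc t - card S))" for S
  define x where "x J = (if J \<subseteq> {1..n} \<and> card J = Suc t then sum g (Pow ({1..n} - J)) else 0)" for J
  have x: "x \<in> layer (ballot n c) (Suc t)"
    unfolding layer_def x_def using c by (auto intro!: ballot_full)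
  have bottom: "upsum n x A = b A" if A: "A \<subseteq> {1..n}" "card A = t" for A
  proof -
    have finA: "finite A" using A(1) finite_subset by blast
    let ?C = "{1..n} - A"
    have "upsum n x A = (\<Sum>T\<in>(\<lambda>a. insert a A) ` ?C. x T)"
      unfolding upsum_def
    proof (rule sum.mono_neutral_right)
      show "\<forall>T\<in>{T. A \<subseteq> T \<and> T \<subseteq> {1..n}} - (\<lambda>a. insert a A) ` ?C. x T = 0"
      proof
        fix T assume T: "T \<in> {T. A \<subseteq> T \<and> T \<subseteq> {1..n}} - (\<lambda>a. insert a A) ` ?C"
        show "x T = 0"
        proof (rule ccontr)
          assume "x T \<noteq> 0"
          then have "card T = Suc t" by (auto simp: x_def split: if_splits)
          then have "card (T - A) = 1" using A(2) T finA by (subst card_Diff_subset) auto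
          then obtain a where "T - A = {a}" by (rule card_1_singletonE)
          then have "T = insert a A" "a \<in> ?C" using T by auto
          then show False using T by blast
        qed
      qed
    qed (use A in \<open>auto intro: finite_subset[of _ "Pow {1..n}"]\<close>)
    also have "\<dots> = (\<Sum>a\<in>?C. x (insert a A))"
      by (subst sum.reindex) (auto simp: inj_on_def)
    also have "\<dots> = (\<Sum>a\<in>?C. \<Sum>S\<in>Pow ?C. if a \<notin> S then g S else 0)"
    proof (rule sum.cong[OF refl])
      fix a assume a: "a \<in> ?C"
      have "Pow ({1..n} - insert a A) = {S \<in> Pow ?C. a \<notin> S}" by auto
      then show "x (insert a A) = (\<Sum>S\<in>Pow ?C. if a \<notin> S then g S else 0)"
        using a A finA unfolding x_def by (subst sum.inter_filter[symmetric]) auto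
    qed
    also have "\<dots> = (\<Sum>S\<in>Pow ?C. \<Sum>a\<in>?C. if a \<notin> S then g S else 0)" by (rule sum.swap)
    also have "\<dots> = (\<Sum>S\<in>Pow ?C. (-1) ^ card S * upsum n b S)"
    proof (rule sum.cong[OF refl])
      fix S assume S: "S \<in> Pow ?C"
      then have finS: "finite S" using finite_subset by blast
      have cC: "card ?C = Suc t" using A finA n by (simp add: card_Diff_subset)
      have le: "card S \<le> Suc t" using card_mono[of ?C S] S cC by simp
      have "{a \<in> ?C. a \<notin> S} = ?C - S" by auto
      then have "card {a \<in> ?C. a \<notin> S} = Suc t - card S"
        using S finS cC by (simp add: card_Diff_subset)
      then have eq: "(\<Sum>a\<in>?C. if a \<notin> S then g S else 0) = int (Suc t - card S) * g S"
        by (subst sum.inter_filter[symmetric]) auto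
      show "(\<Sum>a\<in>?C. if a \<notin> S then g S else 0) = (-1) ^ card S * upsum n b S"
      proof (cases "card S \<le> t")
        case True
        have "S \<subseteq> {1..n}" using S by auto
        then obtain m where "upsum n b S = int (Suc t - card S) * m" using dvd True by (meson dvdE)
        moreover have "int (Suc t - card S) \<noteq> 0" using True by simp
        ultimately have "int (Suc t - card S) * (upsum n b S div int (Suc t - card S)) = upsum n b S"
          by (metis nonzero_mult_div_cancel_left)
        then show ?thesis unfolding eq by (simp only: g_def mult.left_commute)
      next
        case False
        then show ?thesis using upsum_big[OF b, of S] le unfolding eq by simp
      qed
    qed
    also have "\<dots> = (\<Sum>S\<in>Pow ?C. \<Sum>T\<in>Pow {1..n}. if S \<subseteq> T then (-1) ^ card S * b T else 0)"
    proof (rule sum.cong[OF refl])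
      fix S
      have "{T. S \<subseteq> T \<and> T \<subseteq> {1..n}} = {T \<in> Pow {1..n}. S \<subseteq> T}" by auto
      then show "(-1) ^ card S * upsum n b S = (\<Sum>T\<in>Pow {1..n}. if S \<subseteq> T then (-1) ^ card S * b T else 0)"
        unfolding upsum_def sum_distrib_left by (subst sum.inter_filter[symmetric]) auto
    qed
    also have "\<dots> = (\<Sum>T\<in>Pow {1..n}. \<Sum>S\<in>Pow ?C. if S \<subseteq> T then (-1) ^ card S * b T else 0)" by (rule sum.swap)
    also have "\<dots> = (\<Sum>T\<in>Pow {1..n}. if T = A then b T else 0)"
    proof (rule sum.cong[OF refl])
      fix T assume T: "T \<in> Pow {1..n}"
      have finT: "finite T" using T finite_subset by blast
      have "{S \<in> Pow ?C. S \<subseteq> T} = Pow (T - A)" using T by auto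
      then have eq: "(\<Sum>S\<in>Pow ?C. if S \<subseteq> T then (-1) ^ card S * b T else 0) = (if T \<subseteq> A then 1 else 0) * b T"
        using sum_Pow_alternating[of "T - A"] finT
        by (subst sum.inter_filter[symmetric]) (auto simp: sum_distrib_right[symmetric])
      have "T = A" if "T \<subseteq> A" "b T \<noteq> 0"
        using that A(2) b finA card_subset_eq[of A T] unfolding layer_def by auto
      then show "(\<Sum>S\<in>Pow ?C. if S \<subseteq> T then (-1) ^ card S * b T else 0) = (if T = A then b T else 0)"
        unfolding eq by auto
    qed
    also have "\<dots> = b A" using A(1) by simp
    finally show ?thesis .
  qed
  have "int (Suc t - card A) * upsum n x A = upsum n b A" if A: "A \<subseteq> {1..n}" "card A \<le> t" for A
  proof -
    have "int (Suc t - card A) * upsum n x A = (\<Sum>I | A \<subseteq> I \<and> I \<subseteq> {1..n} \<and> card I = t. upsum n x I)"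
      using upsum_layer[OF x A] by simp
    also have "\<dots> = (\<Sum>I | A \<subseteq> I \<and> I \<subseteq> {1..n} \<and> card I = t. b I)"
      using bottom by (intro sum.cong) auto
    also have "\<dots> = upsum n b A" unfolding upsum_def
      using b by (intro sum.mono_neutral_left) (auto simp: layer_def intro: finite_subset[of _ "Pow {1..n}"])
    finally show ?thesis .
  qed
  then show ?thesis using x by blast
qed

lemma layer_remove_top:
  assumes "v \<in> layer (ballot (Suc n) c) j"
  shows "(\<lambda>T. if Suc n \<in> T then 0 else v T) \<in> layer (ballot n (Suc c)) j"
proof (cases c)
  case 0
  then show ?thesis using assms unfolding layer_def by auto
next
  case (Suc d)
  have "A \<in> ballot n (Suc (Suc d))" if "A \<in> ballot (Suc n) (Suc d)" "Suc n \<notin> A" for A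
    using that by auto
  then show ?thesis using assms Suc unfolding layer_def by auto
qed

lemma layer_link_top:
  assumes "v \<in> layer (ballot (Suc n) (Suc c)) (Suc j)"
  shows "(\<lambda>T. if T \<subseteq> {1..n} then v (insert (Suc n) T) else 0) \<in> layer (ballot n c) j"
  unfolding layer_def
proof (clarsimp, rule conjI)
  fix T assume T: "T \<subseteq> {Suc 0..n}" "v (insert (Suc n) T) \<noteq> 0"
  have n: "Suc n \<notin> T" using T by auto
  have fin: "finite T" using T finite_subset by blast
  have ins: "insert (Suc n) T \<in> ballot (Suc n) (Suc c)" "card (insert (Suc n) T) = Suc j"
    using assms T unfolding layer_def by auto
  then show "card T = j" using n fin by simp
  show "T \<in> ballot n c"
    using ins(1) n Suc_notin_ballot[of "insert (Suc n) T" n "Suc (Suc c)"] Suc_notin_ballot[of _ n c]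
    by (auto simp: insert_ident)
qed

lemma layer_add_top:
  assumes "x0 \<in> layer (ballot n (Suc c)) (Suc j)" "x1 \<in> layer (ballot n (c - 1)) j"
    "c = 0 \<Longrightarrow> x1 = (\<lambda>_. 0)"
  shows "(\<lambda>T. if Suc n \<in> T then x1 (T - {Suc n}) else x0 T) \<in> layer (ballot (Suc n) c) (Suc j)"
proof -
  have "T \<in> ballot (Suc n) c \<and> card T = Suc j" if "Suc n \<in> T" "x1 (T - {Suc n}) \<noteq> 0" for T
  proof -
    have T: "T - {Suc n} \<in> ballot n (c - 1)" "card (T - {Suc n}) = j"
      using that assms(2) unfolding layer_def by auto
    have "finite T" using ballot_subset[OF T(1)] finite_subset by fastforce
    then have cT: "card T = Suc j" using card_Suc_Diff1[of T "Suc n"] that(1) T(2) by simp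
    have "c \<noteq> 0" using that(2) assms(3) by auto
    then obtain d where d: "c = Suc d" using not0_implies_Suc by blast
    have "insert (Suc n) (T - {Suc n}) \<in> insert (Suc n) ` ballot n d" using T(1) d by (intro imageI) simp
    moreover have "insert (Suc n) (T - {Suc n}) = T" using that(1) by blast
    ultimately have "T \<in> ballot (Suc n) c" unfolding d ballot.simps by simp
    then show ?thesis using cT by blast
  qed
  moreover have "T \<in> ballot (Suc n) c \<and> card T = Suc j" if "x0 T \<noteq> 0" for T
    using that assms(1) unfolding layer_def by (cases c) auto
  ultimately show ?thesis unfolding layer_def by auto
qed

lemma zero_layer [simp]: "(\<lambda>_. 0) \<in> layer F j"
  by (simp add: layer_def)

lemma layer_diff: "v \<in> layer F j \<Longrightarrow> w \<in> layer F j \<Longrightarrow> (\<lambda>T. v T - w T) \<in> layer F j"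
  unfolding layer_def by force

lemma layer_mono: "F \<subseteq> G \<Longrightarrow> layer F j \<subseteq> layer G j"
  unfolding layer_def by auto

text \<open>Write \<open>b\<close> as \<open>b0\<close> on the sets without the top element and \<open>b1\<close> on those with it (the top element
removed), and \<open>x\<close> likewise. The sets containing the top element require that \<open>x1\<close> solves the problem
for \<open>b1\<close>, one level lower and with starting height \<open>c - 1\<close>; the others then require that \<open>x0\<close> solves it
for \<open>b0 - x1\<close> with starting height \<open>c + 1\<close>. Divisibility for \<open>b0 - x1\<close> follows from that for \<open>b\<close> since the
sums of \<open>b1\<close> are \<open>t - |A|\<close> times those of \<open>x1\<close>, that is, minus those of \<open>x1\<close> modulo \<open>t + 1 - |A|\<close>.\<close>

lemma ballot_lift:
  assumes "2 * t + 1 \<le> n" "3 * t + 2 \<le> n + c"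
    and b: "b \<in> layer (ballot n c) t"
    and dvd: "\<And>A. A \<subseteq> {1..n} \<Longrightarrow> card A \<le> t \<Longrightarrow> int (Suc t - card A) dvd upsum n b A"
  shows "\<exists>x \<in> layer (ballot n c) (Suc t). \<forall>A \<subseteq> {1..n}. card A \<le> t \<longrightarrow>
           int (Suc t - card A) * upsum n x A = upsum n b A"
  using assms
proof (induction n arbitrary: t c b)
  case (Suc n)
  show ?case
  proof (cases "Suc n = 2 * t + 1")
    case True
    then show ?thesis using ballot_lift_square[OF True _ Suc.prems(3,4)] Suc.prems by simp
  next
    case False
    define b0 where "b0 T = (if Suc n \<in> T then 0 else b T)" for T
    define b1 where "b1 T = (if T \<subseteq> {1..n} then b (insert (Suc n) T) else 0)" for T
    have b0: "b0 \<in> layer (ballot n (Suc c)) t"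
      unfolding b0_def using layer_remove_top[OF Suc.prems(3)] .
    have b0_eq: "upsum n b A = upsum n b0 A" for A by (rule upsum_cong) (auto simp: b0_def)
    have b1_eq: "upsum n (\<lambda>T. b (insert (Suc n) T)) A = upsum n b1 A" for A
      by (rule upsum_cong) (auto simp: b1_def)
    have in_eq: "upsum (Suc n) b (insert (Suc n) A) = upsum n b1 A" if "A \<subseteq> {1..n}" for A
    proof -
      have "insert (Suc n) A - {Suc n} = A" using that by auto
      then show ?thesis using upsum_Suc_in[of n "insert (Suc n) A" b] b1_eq[of A] by (metis insertI1)
    qed
    have notin_eq: "upsum (Suc n) b A = upsum n b0 A + upsum n b1 A" if "A \<subseteq> {1..n}" for A
      using upsum_Suc_notin[of n A b] that b0_eq b1_eq by fastforce
    have card_ins: "card (insert (Suc n) A) = Suc (card A)" if "A \<subseteq> {1..n}" for A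
      using that by (subst card_insert_disjoint) (auto intro: finite_subset)
    \<comment> \<open>For \<open>c = 0\<close> or \<open>t = 0\<close> there is no ballot set of size \<open>t\<close> through the top element, and \<open>x1 = 0\<close> is taken.\<close>
    have "\<exists>x1 \<in> layer (ballot n (c - 1)) t. (c = 0 \<longrightarrow> x1 = (\<lambda>_. 0)) \<and>
        (\<forall>A \<subseteq> {1..n}. card A \<le> t \<longrightarrow> int (t - card A) * upsum n x1 A = upsum n b1 A)"
    proof (cases "c = 0 \<or> t = 0")
      case True
      have "b1 A = 0" for A
      proof (rule ccontr)
        assume "b1 A \<noteq> 0"
        then have A: "A \<subseteq> {1..n}" "insert (Suc n) A \<in> ballot (Suc n) c" "card (insert (Suc n) A) = t"
          using Suc.prems(3) unfolding b1_def layer_def by (auto split: if_splits)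
        then show False using True card_ins[of A] Suc_notin_ballot[of "insert (Suc n) A" n 1] by auto
      qed
      then show ?thesis
        using True by (intro bexI[of _ "\<lambda>_. 0"]) (auto simp: upsum_def)
    next
      case False
      then obtain d s where d: "c = Suc d" "t = Suc s" by (meson not0_implies_Suc)
      have b1: "b1 \<in> layer (ballot n d) s"
        unfolding b1_def using layer_link_top Suc.prems(3) d by blast
      have dvd1: "int (Suc s - card A) dvd upsum n b1 A" if "A \<subseteq> {1..n}" "card A \<le> s" for A
        using Suc.prems(4)[of "insert (Suc n) A"] that d in_eq[OF that(1)] card_ins[OF that(1)]
        by fastforce
      obtain x1 where x1: "x1 \<in> layer (ballot n d) t"
        "\<And>A. A \<subseteq> {1..n} \<Longrightarrow> card A \<le> s \<Longrightarrow> int (t - card A) * upsum n x1 A = upsum n b1 A"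
        using Suc.IH[OF _ _ b1 dvd1] Suc.prems d by auto
      have "int (t - card A) * upsum n x1 A = upsum n b1 A" if A: "A \<subseteq> {1..n}" "card A \<le> t" for A
      proof (cases "card A \<le> s")
        case True
        show ?thesis by (rule x1(2)[OF A(1) True])
      next
        case False
        then show ?thesis using upsum_big[OF b1] A d by simp
      qed
      then show ?thesis using x1(1) d by (intro bexI[of _ x1]) auto
    qed
    then obtain x1 where x1: "x1 \<in> layer (ballot n (c - 1)) t" "c = 0 \<Longrightarrow> x1 = (\<lambda>_. 0)"
      "\<And>A. A \<subseteq> {1..n} \<Longrightarrow> card A \<le> t \<Longrightarrow> int (t - card A) * upsum n x1 A = upsum n b1 A" by blast
    have "x1 \<in> layer (ballot n (Suc c)) t"
    proof (cases c)
      case 0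
      then show ?thesis using x1(2) by simp
    next
      case (Suc d)
      have "ballot n d \<subseteq> ballot n (Suc (Suc d))" using ballot_mono by blast
      from layer_mono[OF this, of t] show ?thesis using x1(1) unfolding Suc by auto
    qed
    then have d: "(\<lambda>T. b0 T - x1 T) \<in> layer (ballot n (Suc c)) t" using layer_diff b0 by blast
    have dvd0: "int (Suc t - card A) dvd upsum n (\<lambda>T. b0 T - x1 T) A"
      if A: "A \<subseteq> {1..n}" "card A \<le> t" for A
    proof -
      have "int (Suc t - card A) dvd upsum n b0 A + upsum n b1 A"
        using Suc.prems(4)[of A] A notin_eq[OF A(1)] by fastforce
      moreover have "upsum n b0 A + upsum n b1 A = upsum n (\<lambda>T. b0 T - x1 T) A + int (Suc t - card A) * upsum n x1 A"
        using x1(3)[OF A] A(2) by (simp add: upsum_diff Suc_diff_le algebra_simps)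
      ultimately show ?thesis by (metis dvd_add_left_iff dvd_triv_left)
    qed
    obtain x0 where x0: "x0 \<in> layer (ballot n (Suc c)) (Suc t)"
      "\<And>A. A \<subseteq> {1..n} \<Longrightarrow> card A \<le> t \<Longrightarrow>
         int (Suc t - card A) * upsum n x0 A = upsum n (\<lambda>T. b0 T - x1 T) A"
      using Suc.IH[OF _ _ d dvd0] Suc.prems False by auto
    define x where "x T = (if Suc n \<in> T then x1 (T - {Suc n}) else x0 T)" for T
    have x: "x \<in> layer (ballot (Suc n) c) (Suc t)"
      unfolding x_def using layer_add_top[OF x0(1) x1(1,2)] .
    have X0: "upsum n x A = upsum n x0 A" for A by (rule upsum_cong) (auto simp: x_def)
    have X1: "upsum n (\<lambda>T. x (insert (Suc n) T)) A = upsum n x1 A" for A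
    proof (rule upsum_cong)
      fix T assume "T \<subseteq> {1..n}"
      then have "Suc n \<notin> T" by auto
      then show "x (insert (Suc n) T) = x1 T" by (simp add: x_def)
    qed
    have "int (Suc t - card A) * upsum (Suc n) x A = upsum (Suc n) b A"
      if A: "A \<subseteq> {1..Suc n}" "card A \<le> t" for A
    proof (cases "Suc n \<in> A")
      case True
      define B where "B = A - {Suc n}"
      have B: "B \<subseteq> {1..n}" "A = insert (Suc n) B" using A(1) True by (auto simp: B_def le_Suc_eq)
      have cB: "card A = Suc (card B)" using card_ins B by simp
      have "upsum (Suc n) x A = upsum n x1 B"
        using upsum_Suc_in[of n A x] True X1 by (simp add: B_def)
      moreover have "upsum (Suc n) b A = upsum n b1 B" using in_eq B by simp
      ultimately show ?thesis using x1(3)[OF B(1)] A(2) cB by simp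
    next
      case False
      then have B: "A \<subseteq> {1..n}" using A(1) by (auto simp: le_Suc_eq subset_iff)
      have "int (Suc t - card A) * upsum (Suc n) x A
          = int (Suc t - card A) * upsum n x0 A + int (Suc t - card A) * upsum n x1 A"
        using upsum_Suc_notin[OF False, of x] X0 X1 by (simp add: algebra_simps)
      also have "\<dots> = upsum n b0 A + int (t - card A) * upsum n x1 A"
        using x0(2)[OF B A(2)] A(2) by (simp add: upsum_diff Suc_diff_le algebra_simps)
      also have "\<dots> = upsum (Suc n) b A" using x1(3)[OF B A(2)] notin_eq[OF B] by simp
      finally show ?thesis .
    qed
    then show ?thesis using x by blast
  qed
qed simp

section \<open>Ballot sets span the functions on subsets of fixed size\<close>

definition downsum :: "(nat set \<Rightarrow> int) \<Rightarrow> nat set \<Rightarrow> int" where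
  "downsum g K = sum g (Pow K)"

text \<open>Starting height \<open>0\<close>, where only sets of size \<open>k\<close> occur, is the case of interest; a larger \<open>c\<close> allows values to be
prescribed on all sizes from \<open>k - c\<close> to \<open>k\<close>. This is the form that the recursion preserves: for \<open>c > 0\<close> the part
of \<open>g\<close> through the top element accounts for the differences \<open>f (insert (n + 1) K) - f K\<close>, on the sizes
\<open>k - c\<close> to \<open>k - 1\<close>, and the part avoiding it for one value at each of the sizes \<open>k - c - 1\<close> to \<open>k\<close>.\<close>

lemma ballot_interpolation:
  "\<exists>g. (\<forall>J. g J \<noteq> 0 \<longrightarrow> J \<in> ballot n c) \<and>
       (\<forall>K \<subseteq> {1..n}. card K \<le> k \<longrightarrow> k \<le> card K + c \<longrightarrow> downsum g K = f K)"
proof (induction n c arbitrary: f k rule: ballot.induct)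
  case (1 c)
  show ?case by (rule exI[of _ "\<lambda>J. if J = {} then f {} else 0"]) (auto simp: downsum_def)
next
  case (2 n)
  \<comment> \<open>At height 0 the top element is never used. So a set of size \<open>k - 1\<close> takes over the value of the
    \<open>k\<close>-set obtained by adding the top element, on which \<open>downsum g\<close> is the same.\<close>
  obtain g where g: "\<And>J. g J \<noteq> 0 \<Longrightarrow> J \<in> ballot n 1"
    "\<And>K. K \<subseteq> {1..n} \<Longrightarrow> card K \<le> k \<Longrightarrow> k \<le> card K + 1 \<Longrightarrow>
       downsum g K = f (if card K = k then K else insert (Suc n) K)"
    using "2.IH"[of k "\<lambda>K. f (if card K = k then K else insert (Suc n) K)"] by blast
  have g0: "g (insert (Suc n) J) = 0" for J using g(1) Suc_notin_ballot by blast
  have "downsum g K = f K" if K: "K \<subseteq> {1..Suc n}" "card K = k" for K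
  proof (cases "Suc n \<in> K")
    case True
    define B where "B = K - {Suc n}"
    have B: "B \<subseteq> {1..n}" "K = insert (Suc n) B" "Suc n \<notin> B" "finite B"
      using K(1) True by (auto simp: B_def le_Suc_eq intro: finite_subset)
    have "downsum g K = downsum g B"
      unfolding downsum_def B(2) using B g0 by (simp add: sum_Pow_insert)
    also have "\<dots> = f K" using g(2)[OF B(1)] B K by auto
    finally show ?thesis .
  next
    case False
    then have "K \<subseteq> {1..n}" using K(1) by (auto simp: le_Suc_eq subset_iff)
    then show ?thesis using g(2) K by simp
  qed
  then show ?case using g(1) by (intro exI[of _ g]) auto
next
  case (3 n c)
  \<comment> \<open>If \<open>k = 0\<close> no set containing the top element is concerned, and \<open>g1\<close> is zero.\<close>
  obtain g1 where g1: "\<And>J. g1 J \<noteq> 0 \<Longrightarrow> J \<in> ballot n c"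
    "\<And>K. K \<subseteq> {1..n} \<Longrightarrow> Suc (card K) \<le> k \<Longrightarrow> k \<le> Suc (card K) + c \<Longrightarrow>
       downsum g1 K = f (insert (Suc n) K) - f K"
  proof (cases k)
    case 0
    then show ?thesis using that[of "\<lambda>_. 0"] by simp
  next
    case (Suc i)
    then show ?thesis using "3.IH"(2)[of i "\<lambda>K. f (insert (Suc n) K) - f K"] that by auto
  qed
  obtain g0 where g0: "\<And>J. g0 J \<noteq> 0 \<Longrightarrow> J \<in> ballot n (Suc (Suc c))"
    "\<And>K. K \<subseteq> {1..n} \<Longrightarrow> card K \<le> k \<Longrightarrow> k \<le> card K + Suc (Suc c) \<Longrightarrow>
       downsum g0 K = (if k \<le> card K + Suc c then f K else f (insert (Suc n) K) - downsum g1 K)"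
    using "3.IH"(1)[of k "\<lambda>K. if k \<le> card K + Suc c then f K else f (insert (Suc n) K) - downsum g1 K"]
    by blast
  define g where "g J = (if Suc n \<in> J then g1 (J - {Suc n}) else g0 J)" for J
  have supp: "J \<in> ballot (Suc n) (Suc c)" if "g J \<noteq> 0" for J
  proof (cases "Suc n \<in> J")
    case True
    then have "J - {Suc n} \<in> ballot n c" "J = insert (Suc n) (J - {Suc n})"
      using that g1(1) by (auto simp: g_def)
    then show ?thesis by (metis UnI2 ballot.simps(3) imageI)
  next
    case False
    then show ?thesis using that g0(1) by (simp add: g_def)
  qed
  have low: "downsum g K = downsum g0 K" if "K \<subseteq> {1..n}" for K
    unfolding downsum_def using that by (intro sum.cong) (auto simp: g_def)
  have high: "downsum g (insert (Suc n) K) = downsum g0 K + downsum g1 K" if K: "K \<subseteq> {1..n}" for K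
  proof -
    have "finite K" "Suc n \<notin> K" using K finite_subset by fastforce+
    moreover have "(\<Sum>S\<in>Pow K. g (insert (Suc n) S)) = downsum g1 K"
      unfolding downsum_def
    proof (rule sum.cong[OF refl])
      fix S assume "S \<in> Pow K"
      then have "Suc n \<notin> S" using K by auto
      then show "g (insert (Suc n) S) = g1 S" by (simp add: g_def)
    qed
    ultimately show ?thesis using low[OF K] by (simp add: downsum_def sum_Pow_insert)
  qed
  have "downsum g K = f K" if K: "K \<subseteq> {1..Suc n}" "card K \<le> k" "k \<le> card K + Suc c" for K
  proof (cases "Suc n \<in> K")
    case True
    define B where "B = K - {Suc n}"
    have B: "B \<subseteq> {1..n}" "K = insert (Suc n) B" "Suc n \<notin> B" "finite B"
      using K(1) True by (auto simp: B_def le_Suc_eq intro: finite_subset)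
    have cB: "card K = Suc (card B)" using B by simp
    have "downsum g K = downsum g0 B + downsum g1 B" using high B by simp
    also have "\<dots> = f K" using g0(2)[OF B(1)] g1(2)[OF B(1)] K cB B(2) by auto
    finally show ?thesis .
  next
    case False
    then have "K \<subseteq> {1..n}" using K(1) by (auto simp: le_Suc_eq subset_iff)
    then show ?thesis using g0(2) K low by simp
  qed
  then show ?case using supp by (intro exI[of _ g]) auto
qed

section \<open>Integral bases of groups of functions\<close>

definition zbasis :: "'i set \<Rightarrow> ('i \<Rightarrow> 'a \<Rightarrow> int) \<Rightarrow> ('a \<Rightarrow> int) set \<Rightarrow> bool" where
  "zbasis I x V \<longleftrightarrow> finite I \<and> (\<forall>i\<in>I. x i \<in> V) \<and>
     (\<forall>v\<in>V. \<exists>c. v = (\<lambda>a. \<Sum>i\<in>I. c i * x i a)) \<and>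
     (\<forall>c. (\<forall>a. (\<Sum>i\<in>I. c i * x i a) = 0) \<longrightarrow> (\<forall>i\<in>I. c i = 0))"

lemma zbasis_finite: "zbasis I x V \<Longrightarrow> finite I"
  and zbasis_mem: "zbasis I x V \<Longrightarrow> i \<in> I \<Longrightarrow> x i \<in> V"
  and zbasis_span: "zbasis I x V \<Longrightarrow> v \<in> V \<Longrightarrow> \<exists>c. v = (\<lambda>a. \<Sum>i\<in>I. c i * x i a)"
  and zbasis_indep: "zbasis I x V \<Longrightarrow> (\<And>a. (\<Sum>i\<in>I. c i * x i a) = 0) \<Longrightarrow> i \<in> I \<Longrightarrow> c i = 0"
  unfolding zbasis_def by blast+

text \<open>Only the diagonal entries of the product of the two matrices of coordinates enter into its trace.\<close>

lemma zbasis_coordinates_mult: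
  assumes x: "zbasis I x V" and "finite J"
    and A: "\<And>i. i \<in> I \<Longrightarrow> x i = (\<lambda>a. \<Sum>j\<in>J. A i j * y j a)"
    and B: "\<And>j. j \<in> J \<Longrightarrow> y j = (\<lambda>a. \<Sum>i\<in>I. B j i * x i a)"
    and i: "i \<in> I"
  shows "(\<Sum>j\<in>J. A i j * B j i) = 1"
proof -
  have "(\<Sum>i'\<in>I. ((\<Sum>j\<in>J. A i j * B j i') - (if i' = i then 1 else 0)) * x i' a) = 0" for a
  proof -
    have "x i a = (\<Sum>j\<in>J. A i j * (\<Sum>i'\<in>I. B j i' * x i' a))"
      unfolding fun_cong[OF A[OF i], of a]
    proof (rule sum.cong[OF refl])
      fix j assume "j \<in> J"
      from fun_cong[OF B[OF this], of a] show "A i j * y j a = A i j * (\<Sum>i'\<in>I. B j i' * x i' a)" by simp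
    qed
    also have "\<dots> = (\<Sum>j\<in>J. \<Sum>i'\<in>I. A i j * B j i' * x i' a)"
      by (simp add: sum_distrib_left mult.assoc)
    also have "\<dots> = (\<Sum>i'\<in>I. \<Sum>j\<in>J. A i j * B j i' * x i' a)" by (rule sum.swap)
    also have "\<dots> = (\<Sum>i'\<in>I. (\<Sum>j\<in>J. A i j * B j i') * x i' a)"
      by (simp add: sum_distrib_right)
    finally have 1: "x i a = \<dots>" .
    have 2: "(\<Sum>i'\<in>I. (if i' = i then 1 else 0) * x i' a) = x i a"
      using i zbasis_finite[OF x] by (subst sum.remove[of _ i]) auto
    show ?thesis unfolding left_diff_distrib sum_subtractf 2 using 1 by simp
  qed
  from zbasis_indep[OF x this i] show ?thesis by simp
qed

text \<open>With \<open>A\<close> and \<open>B\<close> the two matrices of coordinates, both \<open>A * B\<close> and \<open>B * A\<close> are identity matrices, and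
they have the same trace.\<close>

lemma zbasis_card:
  assumes x: "zbasis I x V" and y: "zbasis J y V"
  shows "card I = card J"
proof -
  have "\<exists>c. x i = (\<lambda>a. \<Sum>j\<in>J. c j * y j a)" if "i \<in> I" for i
    using zbasis_span[OF y zbasis_mem[OF x that]] .
  then obtain A where A: "\<And>i. i \<in> I \<Longrightarrow> x i = (\<lambda>a. \<Sum>j\<in>J. A i j * y j a)" by metis
  have "\<exists>c. y j = (\<lambda>a. \<Sum>i\<in>I. c i * x i a)" if "j \<in> J" for j
    using zbasis_span[OF x zbasis_mem[OF y that]] .
  then obtain B where B: "\<And>j. j \<in> J \<Longrightarrow> y j = (\<lambda>a. \<Sum>i\<in>I. B j i * x i a)" by metis
  note fin = zbasis_finite[OF x] zbasis_finite[OF y]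
  have "int (card I) = (\<Sum>i\<in>I. \<Sum>j\<in>J. A i j * B j i)"
    using zbasis_coordinates_mult[OF x fin(2) A B] by simp
  also have "\<dots> = (\<Sum>j\<in>J. \<Sum>i\<in>I. B j i * A i j)"
    by (subst sum.swap) (simp add: mult.commute)
  also have "\<dots> = int (card J)"
    using zbasis_coordinates_mult[OF y fin(1) B A] by simp
  finally show ?thesis by simp
qed

text \<open>Subgroups of free abelian groups of finite rank are free. One coordinate \<open>a\<close> is treated at a time: a
function \<open>h0\<close> in \<open>H\<close> with least positive value at \<open>a\<close> completes a basis of the functions in \<open>H\<close> that vanish
at \<open>a\<close>, by division with remainder.\<close>

lemma zbasis_subgroup_exists:
  assumes "finite S" "\<And>h a. h \<in> H \<Longrightarrow> h a \<noteq> 0 \<Longrightarrow> a \<in> S"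
    and zero: "(\<lambda>_. 0) \<in> H"
    and lin: "\<And>u v c. u \<in> H \<Longrightarrow> v \<in> H \<Longrightarrow> (\<lambda>a. u a - c * v a) \<in> H"
  shows "\<exists>(m :: nat) x. zbasis {..<m} x H"
  using assms
proof (induction S arbitrary: H rule: finite_induct)
  case empty
  have "h = (\<lambda>_. 0)" if "h \<in> H" for h using empty(1)[OF that] by (intro ext) blast
  then have "\<forall>h\<in>H. h = (\<lambda>_. 0)" by blast
  then have "zbasis {..<0 :: nat} (\<lambda>_ _. 0) H" unfolding zbasis_def by simp
  then show ?case by blast
next
  case (insert a S)
  define H' where "H' = {h \<in> H. h a = 0}"
  have "\<exists>(m :: nat) x. zbasis {..<m} x H'"
  proof (rule insert.IH)
    show "b \<in> S" if "h \<in> H'" "h b \<noteq> 0" for h b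
      using that insert.prems(1)[of h b] by (auto simp: H'_def)
    show "(\<lambda>_. 0) \<in> H'" using insert.prems(2) by (simp add: H'_def)
    show "(\<lambda>b. u b - c * v b) \<in> H'" if "u \<in> H'" "v \<in> H'" for u v c
      using insert.prems(3)[of u v c] that by (simp add: H'_def)
  qed
  then obtain m :: nat and x where x: "zbasis {..<m} x H'" by blast
  show ?case
  proof (cases "\<forall>h\<in>H. h a = 0")
    case True
    then have "H' = H" by (auto simp: H'_def)
    then show ?thesis using x by blast
  next
    case False
    then obtain h1 where h1: "h1 \<in> H" "h1 a \<noteq> 0" by blast
    have "\<exists>h \<in> H. h a > 0"
    proof (cases "h1 a > 0")
      case False
      then have "0 - 1 * h1 a > 0" using h1(2) by simp
      then show ?thesis by (rule bexI[where x = "\<lambda>b. 0 - 1 * h1 b"])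
        (rule insert.prems(3)[OF insert.prems(2) h1(1)])
    qed (use h1 in blast)
    then obtain h2 where h2: "h2 \<in> H \<and> h2 a > 0" by blast
    obtain h0 where h0: "h0 \<in> H" "h0 a > 0"
      and min: "\<And>h. h \<in> H \<Longrightarrow> h a > 0 \<Longrightarrow> nat (h0 a) \<le> nat (h a)"
      using ex_has_least_nat[of "\<lambda>h. h \<in> H \<and> h a > 0", OF h2, of "\<lambda>h. nat (h a)"] by blast
    define x' where "x' i = (if i < m then x i else h0)" for i
    have sum_x': "(\<Sum>i<Suc m. c i * x' i b) = (\<Sum>i<m. c i * x i b) + c m * h0 b" for c b
      by (simp add: x'_def)
    have "\<exists>c. v = (\<lambda>b. \<Sum>i<Suc m. c i * x' i b)" if v: "v \<in> H" for v
    proof -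
      define q where "q = v a div h0 a"
      define u where "u b = v b - q * h0 b" for b
      have uH: "u \<in> H" unfolding u_def using insert.prems(3)[OF v h0(1)] .
      have ua: "u a = v a mod h0 a" unfolding u_def q_def by (simp add: minus_div_mult_eq_mod)
      have "u a = 0"
      proof (rule ccontr)
        assume "u a \<noteq> 0"
        moreover have "0 \<le> u a" "u a < h0 a" using ua h0(2) by simp_all
        ultimately have "0 < u a" "u a < h0 a" by linarith+
        then show False using min[OF uH] by linarith
      qed
      then have "u \<in> H'" using uH by (simp add: H'_def)
      then obtain c where c: "u = (\<lambda>b. \<Sum>i<m. c i * x i b)" using zbasis_span[OF x] by blast
      have "v b = (\<Sum>i<Suc m. (if i < m then c i else q) * x' i b)" for b
        using fun_cong[OF c, of b] unfolding sum_x' u_def by simp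
      then show ?thesis by (intro exI[of _ "\<lambda>i. if i < m then c i else q"] ext)
    qed
    moreover have "c i = 0" if c: "\<And>b. (\<Sum>i<Suc m. c i * x' i b) = 0" and i: "i < Suc m" for c i
    proof -
      have "x i a = 0" if "i < m" for i using zbasis_mem[OF x, of i] that by (simp add: H'_def)
      then have "c m * h0 a = 0" using c[of a] unfolding sum_x' by simp
      then have cm: "c m = 0" using h0(2) by simp
      then have "(\<Sum>i<m. c i * x i b) = 0" for b using c[of b] unfolding sum_x' by simp
      then have "c i = 0" if "i < m" using zbasis_indep[OF x] that by blast
      then show ?thesis using cm i less_Suc_eq by auto
    qed
    moreover have "\<forall>i\<in>{..<Suc m}. x' i \<in> H"
      using zbasis_mem[OF x] h0(1) by (simp add: x'_def H'_def)
    ultimately have "zbasis {..<Suc m} x' H" unfolding zbasis_def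
      by (intro conjI allI impI ballI) simp_all
    then show ?thesis by blast
  qed
qed

lemma zbasis_layer:
  assumes "finite F"
  shows "zbasis {J \<in> F. card J = j} (\<lambda>J A. if A = J then 1 else 0) (layer F j)"
proof -
  have eq: "(\<Sum>J | J \<in> F \<and> card J = j. c J * (if A = J then 1 else 0)) = (if A \<in> F \<and> card A = j then c A else 0)"
    for c :: "nat set \<Rightarrow> int" and A
    using assms by (simp add: if_distrib[of "\<lambda>z. _ * z"] cong: if_cong)
  show ?thesis
    unfolding zbasis_def eq
  proof (intro conjI ballI allI impI)
    fix v assume v: "v \<in> layer F j"
    then have "v = (\<lambda>A. if A \<in> F \<and> card A = j then v A else 0)"
      by (intro ext) (auto simp: layer_def)
    then show "\<exists>c. v = (\<lambda>A. if A \<in> F \<and> card A = j then c A else 0)" by blast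
  next
    fix c :: "nat set \<Rightarrow> int" and J
    assume "\<forall>A. (if A \<in> F \<and> card A = j then c A else 0) = 0" "J \<in> {J \<in> F. card J = j}"
    then show "c J = 0" by (auto split: if_splits)
  qed (use assms in \<open>auto simp: layer_def\<close>)
qed

lemma upsum_linear: "upsum n (\<lambda>A. \<Sum>i\<in>I. c i * x i A) B = (\<Sum>i\<in>I. c i * upsum n (x i) B)"
  unfolding upsum_def by (subst sum.swap) (simp add: sum_distrib_left)

section \<open>Splitting the ballot layers into chains\<close>

text \<open>The pair \<open>(s, q)\<close> stands for the chain with number \<open>q\<close> among those that start at level \<open>s\<close>; these are the
chains present at level \<open>i\<close>.\<close>

definition blocks :: "(nat \<Rightarrow> nat) \<Rightarrow> nat \<Rightarrow> (nat \<times> nat) set" where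
  "blocks r i = (SIGMA s:{..i}. {..<r s})"

text \<open>The chain \<open>b\<close> consists of the functions \<open>x b i\<close> with \<open>fst b \<le> i \<le> j\<close>. Their superset sums follow the pattern of
the divided derivatives of the monomials \<open>X ^ (i - fst b)\<close>. At each level all chains present form a basis.\<close>

definition binomial_chains ::
    "nat \<Rightarrow> nat \<Rightarrow> (nat \<Rightarrow> nat) \<Rightarrow> (nat \<times> nat \<Rightarrow> nat \<Rightarrow> nat set \<Rightarrow> int) \<Rightarrow> bool" where
  "binomial_chains n j r x \<longleftrightarrow> (\<forall>i\<le>j.
     zbasis (blocks r i) (\<lambda>b. x b i) (layer (ballot n 0) i) \<and>
     (\<forall>b \<in> blocks r i. \<forall>A \<subseteq> {1..n}. card A \<le> i \<longrightarrow> upsum n (x b i) A =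
        (if fst b \<le> card A then int ((i - fst b) choose (card A - fst b)) * x b (card A) A else 0)))"

lemma finite_blocks [simp]: "finite (blocks r i)"
  by (simp add: blocks_def)

lemma blocks_Suc: "blocks r (Suc t) = blocks r t \<union> Pair (Suc t) ` {..<r (Suc t)}"
  by (auto simp: blocks_def le_Suc_eq)

lemma blocks_le: "i \<le> t \<Longrightarrow> blocks r i = {b \<in> blocks r t. fst b \<le> i}"
  by (auto simp: blocks_def)

lemma sum_blocks_Suc:
  "(\<Sum>b\<in>blocks r (Suc t). f b) = (\<Sum>b\<in>blocks r t. f b) + (\<Sum>q<r (Suc t). f (Suc t, q))"
proof -
  have "blocks r t \<inter> Pair (Suc t) ` {..<r (Suc t)} = {}" by (auto simp: blocks_def)
  then have "(\<Sum>b\<in>blocks r (Suc t). f b) = (\<Sum>b\<in>blocks r t. f b) + (\<Sum>b\<in>Pair (Suc t) ` {..<r (Suc t)}. f b)"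
    unfolding blocks_Suc by (intro sum.union_disjoint) auto
  also have "(\<Sum>b\<in>Pair (Suc t) ` {..<r (Suc t)}. f b) = (\<Sum>q<r (Suc t). f (Suc t, q))"
    by (subst sum.reindex) (auto simp: inj_on_def)
  finally show ?thesis .
qed

lemma layer_restrict_upsum:
  assumes z: "z \<in> layer (ballot n 0) j"
  shows "(\<lambda>A. if A \<subseteq> {1..n} \<and> card A = i then upsum n z A else 0) \<in> layer (ballot n 0) i"
proof -
  have "A \<in> ballot n 0" if "upsum n z A \<noteq> 0" for A
  proof -
    obtain T where T: "A \<subseteq> T" "z T \<noteq> 0"
    proof (rule ccontr)
      assume "\<not> thesis"
      then have "\<forall>T. A \<subseteq> T \<longrightarrow> z T = 0" using that by blast
      then have "upsum n z A = 0" unfolding upsum_def by (intro sum.neutral) simp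
      then show False using \<open>upsum n z A \<noteq> 0\<close> by simp
    qed
    have "T \<in> ballot n 0" using z T(2) unfolding layer_def by simp
    then show ?thesis using ballot_down T(1) by blast
  qed
  then show ?thesis unfolding layer_def by auto
qed

text \<open>The next member must have superset sums that, multiplied by \<open>t + 1 - |A|\<close>, are those of \<open>(t + 1 - s) * x\<^sub>t\<close>,
where \<open>s\<close> is the start of the chain. The required divisibility is the absorption identity
\<open>(t + 1 - i) * (t + 1 - s choose i - s) = (t + 1 - s) * (t - s choose i - s)\<close>.\<close>

lemma binomial_chains_lift:
  assumes n: "3 * Suc t \<le> n + 1" and ch: "binomial_chains n t r x" and b: "b \<in> blocks r t"
  shows "\<exists>y \<in> layer (ballot n 0) (Suc t). \<forall>A \<subseteq> {1..n}. card A \<le> t \<longrightarrow> upsum n y A =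
    (if fst b \<le> card A then int ((Suc t - fst b) choose (card A - fst b)) * x b (card A) A else 0)"
proof -
  let ?R = "\<lambda>A. if fst b \<le> card A then int ((Suc t - fst b) choose (card A - fst b)) * x b (card A) A else 0"
  define v where "v A = int (Suc t - fst b) * x b t A" for A
  have bt: "fst b \<le> t" using b by (auto simp: blocks_def)
  have xb: "x b t \<in> layer (ballot n 0) t"
    using ch b zbasis_mem[of "blocks r t" "\<lambda>b. x b t"] unfolding binomial_chains_def by blast
  have v: "v \<in> layer (ballot n 0) t" using xb unfolding layer_def v_def by auto
  have ups: "upsum n v A = int (Suc t - card A) * ?R A" if A: "A \<subseteq> {1..n}" "card A \<le> t" for A
  proof -
    have "upsum n v A = int (Suc t - fst b) * upsum n (x b t) A"
      unfolding upsum_def v_def by (simp add: sum_distrib_left)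
    also have "upsum n (x b t) A =
        (if fst b \<le> card A then int ((t - fst b) choose (card A - fst b)) * x b (card A) A else 0)"
      using ch b A unfolding binomial_chains_def by blast
    finally have eq: "upsum n v A = int (Suc t - fst b) * \<dots>" .
    show ?thesis
    proof (cases "fst b \<le> card A")
      case True
      have "(Suc t - fst b - (card A - fst b)) * (Suc t - fst b choose (card A - fst b))
          = (Suc t - fst b) * ((Suc t - fst b - 1) choose (card A - fst b))"
        by (rule binomial_absorb_comp)
      moreover have "Suc t - fst b - (card A - fst b) = Suc t - card A" "Suc t - fst b - 1 = t - fst b"
        using True A(2) bt by auto
      ultimately have "int (Suc t - card A) * int (Suc t - fst b choose (card A - fst b))
          = int (Suc t - fst b) * int ((t - fst b) choose (card A - fst b))"
        by (metis of_nat_mult)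
      then show ?thesis using eq True by (simp only: if_True mult.assoc[symmetric])
    qed (use eq in simp)
  qed
  have "int (Suc t - card A) dvd upsum n v A" if "A \<subseteq> {1..n}" "card A \<le> t" for A
    using ups[OF that] by simp
  then obtain y where y: "y \<in> layer (ballot n 0) (Suc t)"
    "\<And>A. A \<subseteq> {1..n} \<Longrightarrow> card A \<le> t \<Longrightarrow> int (Suc t - card A) * upsum n y A = upsum n v A"
    using ballot_lift[of t n 0 v] n v by auto
  have "upsum n y A = ?R A" if A: "A \<subseteq> {1..n}" "card A \<le> t" for A
  proof -
    have "int (Suc t - card A) * upsum n y A = int (Suc t - card A) * ?R A"
      using y(2)[OF A] ups[OF A] by simp
    then show ?thesis using A(2) by simp
  qed
  then show ?thesis using y(1) by blast
qed

text \<open>The prolonged chains \<open>y\<close> together with a basis \<open>w\<close> of the functions whose lower superset sums all vanish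
form the next level. Independence is seen on superset sums over \<open>t\<close>-sets, where \<open>w\<close> disappears and \<open>y\<close> becomes a
multiple of the old basis. For spanning, let \<open>c\<close> be the coordinates of the superset sums of \<open>z\<close> at level \<open>t\<close>;
the point is that \<open>t + 1 - s\<close> divides the coordinate at a chain starting at \<open>s\<close>. This is read off after a
further passage to superset sums at level \<open>s\<close>. There the coordinate enters with binomial coefficient \<open>1\<close>, while
\<open>upsum_layer\<close> shows that the result is \<open>t + 1 - s\<close> times the superset sums of \<open>z\<close> themselves, which are an
integral combination of the basis at level \<open>s\<close>.\<close>

lemma binomial_chains_extend:
  assumes n: "3 * Suc t \<le> n + 1" and ch: "binomial_chains n t r x"
  shows "\<exists>r' x'. binomial_chains n (Suc t) r' x'"
proof -
  let ?X = "\<lambda>i. layer (ballot n 0) i"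
  have basis: "zbasis (blocks r i) (\<lambda>b. x b i) (?X i)" if "i \<le> t" for i
    using ch that unfolding binomial_chains_def by blast
  have ups_x: "upsum n (x b i) A =
      (if fst b \<le> card A then int ((i - fst b) choose (card A - fst b)) * x b (card A) A else 0)"
    if "i \<le> t" "b \<in> blocks r i" "A \<subseteq> {1..n}" "card A \<le> i" for i b A
    using ch that unfolding binomial_chains_def by blast
  have supp: "A \<subseteq> {1..n} \<and> card A = i" if "v \<in> ?X i" "v A \<noteq> 0" for v i A
    using that ballot_subset unfolding layer_def by blast
  obtain y where y: "\<And>b. b \<in> blocks r t \<Longrightarrow> y b \<in> ?X (Suc t)"
    and ups_y: "\<And>b A. b \<in> blocks r t \<Longrightarrow> A \<subseteq> {1..n} \<Longrightarrow> card A \<le> t \<Longrightarrow> upsum n (y b) A =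
      (if fst b \<le> card A then int ((Suc t - fst b) choose (card A - fst b)) * x b (card A) A else 0)"
    using binomial_chains_lift[OF n ch] by metis
  have ups_y_t: "upsum n (y b) A = int (Suc t - fst b) * x b t A"
    if "b \<in> blocks r t" "A \<subseteq> {1..n}" "card A = t" for b A
  proof -
    have "fst b \<le> t" using that(1) by (auto simp: blocks_def)
    then have "(Suc t - fst b) choose (t - fst b) = Suc t - fst b"
      by (simp add: Suc_diff_le)
    then show ?thesis using ups_y[OF that(1,2)] that(3) \<open>fst b \<le> t\<close> by simp
  qed
  define H where "H = {z \<in> ?X (Suc t). \<forall>A \<subseteq> {1..n}. card A \<le> t \<longrightarrow> upsum n z A = 0}"
  have ups_lin: "upsum n (\<lambda>a. u a - c * v a) A = upsum n u A - c * upsum n v A" for u v c A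
    unfolding upsum_def by (simp add: sum_subtractf sum_distrib_left)
  have lin: "(\<lambda>a. u a - c * v a) \<in> ?X j" if "u \<in> ?X j" "v \<in> ?X j" for u v c j
    using that unfolding layer_def by force
  have "\<exists>(m :: nat) w. zbasis {..<m} w H"
  proof (rule zbasis_subgroup_exists)
    show "h \<in> H \<Longrightarrow> h a \<noteq> 0 \<Longrightarrow> a \<in> ballot n 0" for h a by (auto simp: H_def layer_def)
    show "(\<lambda>_. 0) \<in> H" by (simp add: H_def upsum_def)
    show "u \<in> H \<Longrightarrow> v \<in> H \<Longrightarrow> (\<lambda>a. u a - c * v a) \<in> H" for u v c
      unfolding H_def using lin by (simp add: ups_lin)
  qed simp
  then obtain m :: nat and w where w: "zbasis {..<m} w H" by blast
  have wH: "w q \<in> H" if "q < m" for q using zbasis_mem[OF w] that by blast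
  define r' where "r' = r(Suc t := m)"
  define x' where "x' b i = (if i = Suc t then (if fst b = Suc t then w (snd b) else y b) else x b i)" for b i
  have blk: "blocks r' i = blocks r i" if "i \<le> t" for i
    using that by (auto simp: blocks_def r'_def)
  have blk_t: "fst b \<le> t" if "b \<in> blocks r t" for b using that by (auto simp: blocks_def)
  have blk_Suc: "b \<in> blocks r t \<or> (\<exists>q<m. b = (Suc t, q))" if "b \<in> blocks r' (Suc t)" for b
    using that unfolding blocks_Suc blk[OF order_refl] by (auto simp: r'_def)
  have sum_x': "(\<Sum>b\<in>blocks r' (Suc t). c b * x' b (Suc t) a)
      = (\<Sum>b\<in>blocks r t. c b * y b a) + (\<Sum>q<m. c (Suc t, q) * w q a)" for c a
  proof -
    have "(\<Sum>b\<in>blocks r t. c b * x' b (Suc t) a) = (\<Sum>b\<in>blocks r t. c b * y b a)"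
      using blk_t by (intro sum.cong) (force simp: x'_def)+
    then show ?thesis unfolding sum_blocks_Suc blk[OF order_refl] by (simp add: r'_def x'_def)
  qed
  have mem: "x' b (Suc t) \<in> ?X (Suc t)" if b: "b \<in> blocks r' (Suc t)" for b
  proof -
    consider "b \<in> blocks r t" | q where "b = (Suc t, q)" "q < m"
      using blk_Suc b by blast
    then show ?thesis
    proof cases
      case 1
      then show ?thesis using y blk_t[OF 1] by (simp add: x'_def)
    next
      case 2
      then show ?thesis using wH[OF 2(2)] by (simp add: x'_def H_def)
    qed
  qed
  have span: "\<exists>c. z = (\<lambda>a. \<Sum>b\<in>blocks r' (Suc t). c b * x' b (Suc t) a)" if z: "z \<in> ?X (Suc t)" for z
  proof -
    define v where "v i A = (if A \<subseteq> {1..n} \<and> card A = i then upsum n z A else 0)" for i A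
    have v: "v i \<in> ?X i" for i unfolding v_def by (rule layer_restrict_upsum[OF z])
    obtain c where c: "v t = (\<lambda>a. \<Sum>b\<in>blocks r t. c b * x b t a)"
      using zbasis_span[OF basis[OF order_refl] v] by blast
    have ups_v: "upsum n (v t) A = int (Suc t - card A) * upsum n z A"
      if A: "A \<subseteq> {1..n}" "card A \<le> t" for A
    proof -
      have "upsum n (v t) A = (\<Sum>I | A \<subseteq> I \<and> I \<subseteq> {1..n} \<and> card I = t. upsum n z I)"
        unfolding upsum_def[of n "v t"]
        by (rule sum.mono_neutral_cong_right) (auto simp: v_def intro: finite_subset[of _ "Pow {1..n}"])
      then show ?thesis using upsum_layer[OF z A] by simp
    qed
    have dvd: "int (Suc t - fst b) dvd c b" if b: "b \<in> blocks r t" for b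
    proof -
      define s where "s = fst b"
      have s: "s \<le> t" using blk_t b by (simp add: s_def)
      obtain d where d: "v s = (\<lambda>a. \<Sum>b\<in>blocks r s. d b * x b s a)"
        using zbasis_span[OF basis[OF s] v] by blast
      have "(\<Sum>b\<in>blocks r s. (c b * int ((t - fst b) choose (s - fst b)) - int (Suc t - s) * d b) * x b s A) = 0" for A
      proof (cases "A \<subseteq> {1..n} \<and> card A = s")
        case True
        then have A: "A \<subseteq> {1..n}" "card A = s" by auto
        have "int (Suc t - s) * v s A = upsum n (v t) A"
          using ups_v A s by (simp add: v_def)
        also have "\<dots> = (\<Sum>b\<in>blocks r t. c b * upsum n (x b t) A)"
          unfolding c by (rule upsum_linear)
        also have "\<dots> = (\<Sum>b\<in>blocks r t. if fst b \<le> s then c b * int ((t - fst b) choose (s - fst b)) * x b s A else 0)"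
          using A s by (intro sum.cong) (auto simp: ups_x)
        also have "\<dots> = (\<Sum>b\<in>blocks r s. c b * int ((t - fst b) choose (s - fst b)) * x b s A)"
          unfolding blocks_le[OF s] by (subst sum.inter_filter[symmetric]) auto
        finally have "(\<Sum>b\<in>blocks r s. c b * int ((t - fst b) choose (s - fst b)) * x b s A) = int (Suc t - s) * v s A" ..
        also have "\<dots> = (\<Sum>b\<in>blocks r s. int (Suc t - s) * d b * x b s A)"
          unfolding d by (simp add: sum_distrib_left mult.assoc)
        finally show ?thesis by (simp add: left_diff_distrib sum_subtractf)
      next
        case False
        then have "x b s A = 0" if "b \<in> blocks r s" for b
          using supp[OF zbasis_mem[OF basis[OF s] that], of A] by blast
        then show ?thesis by simp
      qed
      moreover have "b \<in> blocks r s" using b s by (auto simp: blocks_def s_def)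
      ultimately have "c b * int ((t - fst b) choose (s - fst b)) - int (Suc t - s) * d b = 0"
        by (rule zbasis_indep[OF basis[OF s],
              of "\<lambda>b. c b * int ((t - fst b) choose (s - fst b)) - int (Suc t - s) * d b"])
      then show ?thesis by (simp add: s_def)
    qed
    define c' where "c' b = c b div int (Suc t - fst b)" for b
    have c': "c' b * int (Suc t - fst b) = c b" if "b \<in> blocks r t" for b
      using dvd[OF that] by (simp add: c'_def)
    \<comment> \<open>Subtracting the prolonged chains with the divided coordinates kills the superset sums at level \<open>t\<close>, and
      by \<open>upsum_layer\<close> all lower ones.\<close>
    define z' where "z' A = z A - 1 * (\<Sum>b\<in>blocks r t. c' b * y b A)" for A
    have "(\<lambda>A. \<Sum>b\<in>blocks r t. c' b * y b A) \<in> ?X (Suc t)"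
      unfolding layer_def
    proof (clarify)
      fix A assume "(\<Sum>b\<in>blocks r t. c' b * y b A) \<noteq> 0"
      then obtain b where "b \<in> blocks r t" "y b A \<noteq> 0"
        by (metis (no_types, lifting) mult_zero_right sum.neutral)
      then show "A \<in> ballot n 0 \<and> card A = Suc t" using y unfolding layer_def by blast
    qed
    then have z'X: "z' \<in> ?X (Suc t)" unfolding z'_def using lin z by blast
    have top: "upsum n z' A = 0" if A: "A \<subseteq> {1..n}" "card A = t" for A
    proof -
      have "upsum n z' A = upsum n z A - (\<Sum>b\<in>blocks r t. c' b * upsum n (y b) A)"
        unfolding z'_def ups_lin by (simp add: upsum_linear)
      also have "(\<Sum>b\<in>blocks r t. c' b * upsum n (y b) A) = (\<Sum>b\<in>blocks r t. c b * x b t A)"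
        using A by (intro sum.cong) (auto simp: ups_y_t c'[symmetric])
      also have "\<dots> = v t A" by (simp add: c)
      finally show ?thesis using A by (simp add: v_def)
    qed
    have "upsum n z' A = 0" if A: "A \<subseteq> {1..n}" "card A \<le> t" for A
    proof -
      have "int (Suc t - card A) * upsum n z' A = 0"
        unfolding upsum_layer[OF z'X A, symmetric] using top by (intro sum.neutral) auto
      then show ?thesis using A(2) by simp
    qed
    then have "z' \<in> H" using z'X by (simp add: H_def)
    then obtain d where d: "z' = (\<lambda>a. \<Sum>q<m. d q * w q a)" using zbasis_span[OF w] by blast
    define e where "e b = (if fst b = Suc t then d (snd b) else c' b)" for b
    have "(\<Sum>b\<in>blocks r t. e b * y b a) = (\<Sum>b\<in>blocks r t. c' b * y b a)" for a
      using blk_t by (intro sum.cong) (force simp: e_def)+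
    then have "z a = (\<Sum>b\<in>blocks r' (Suc t). e b * x' b (Suc t) a)" for a
      using fun_cong[OF d, of a] unfolding sum_x' z'_def by (simp add: e_def)
    then show ?thesis by blast
  qed
  have indep: "c b = 0" if c: "\<And>a. (\<Sum>b\<in>blocks r' (Suc t). c b * x' b (Suc t) a) = 0"
    and b: "b \<in> blocks r' (Suc t)" for c b
  proof -
    have c0: "(\<Sum>b\<in>blocks r t. c b * y b a) + (\<Sum>q<m. c (Suc t, q) * w q a) = 0" for a
      using c[of a] unfolding sum_x' .
    have "(\<Sum>b\<in>blocks r t. (c b * int (Suc t - fst b)) * x b t A) = 0" for A
    proof (cases "A \<subseteq> {1..n} \<and> card A = t")
      case True
      have "0 = upsum n (\<lambda>a. (\<Sum>b\<in>blocks r t. c b * y b a) - (-1) * (\<Sum>q<m. c (Suc t, q) * w q a)) A"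
        using c0 by (simp add: upsum_def)
      also have "\<dots> = (\<Sum>b\<in>blocks r t. c b * upsum n (y b) A) + (\<Sum>q<m. c (Suc t, q) * upsum n (w q) A)"
        unfolding ups_lin upsum_linear by simp
      also have "(\<Sum>q<m. c (Suc t, q) * upsum n (w q) A) = 0"
        using wH True by (intro sum.neutral) (auto simp: H_def)
      also have "(\<Sum>b\<in>blocks r t. c b * upsum n (y b) A) = (\<Sum>b\<in>blocks r t. (c b * int (Suc t - fst b)) * x b t A)"
        using True by (intro sum.cong) (auto simp: ups_y_t)
      finally show ?thesis by simp
    next
      case False
      then have "x b t A = 0" if "b \<in> blocks r t" for b
        using supp[OF zbasis_mem[OF basis[OF order_refl] that], of A] by blast
      then show ?thesis by simp
    qed
    then have "c b * int (Suc t - fst b) = 0" if "b \<in> blocks r t" for b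
      using that by (rule zbasis_indep[OF basis[OF order_refl], of "\<lambda>b. c b * int (Suc t - fst b)"])
    then have c1: "c b = 0" if "b \<in> blocks r t" for b
      using that blk_t[OF that] by fastforce
    then have "(\<Sum>q<m. c (Suc t, q) * w q a) = 0" for a using c0[of a] by simp
    then have "c (Suc t, q) = 0" if "q < m" for q
      using that zbasis_indep[OF w, of "\<lambda>q. c (Suc t, q)" q] by simp
    moreover have "b \<in> blocks r t \<or> (\<exists>q<m. b = (Suc t, q))"
      using blk_Suc b by blast
    ultimately show ?thesis using c1 by blast
  qed
  have top_basis: "zbasis (blocks r' (Suc t)) (\<lambda>b. x' b (Suc t)) (?X (Suc t))"
    unfolding zbasis_def using mem span indep by auto
  have "binomial_chains n (Suc t) r' x'"
    unfolding binomial_chains_def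
  proof (intro allI impI conjI ballI)
    fix i assume i: "i \<le> Suc t"
    show "zbasis (blocks r' i) (\<lambda>b. x' b i) (?X i)"
    proof (cases "i = Suc t")
      case False
      then show ?thesis using i basis[of i] by (simp add: blk x'_def)
    qed (use top_basis in simp)
    fix b A assume b: "b \<in> blocks r' i" and A: "A \<subseteq> {1..n}" "card A \<le> i"
    show "upsum n (x' b i) A =
      (if fst b \<le> card A then int ((i - fst b) choose (card A - fst b)) * x' b (card A) A else 0)"
    proof (cases "i = Suc t")
      case False
      then show ?thesis using i b A ups_x[of i b A] by (simp add: blk x'_def)
    next
      case True
      show ?thesis
      proof (cases "card A = Suc t")
        case cA: True
        have "fst b \<le> Suc t" using b True by (auto simp: blocks_def)
        then show ?thesis using upsum_same[OF mem cA A(1)] b True cA by simp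
      next
        case False
        then have cA: "card A \<le> t" using A True by simp
        consider "b \<in> blocks r t" | q where "b = (Suc t, q)" "q < m"
          using blk_Suc b True by blast
        then show ?thesis
        proof cases
          case 1
          then show ?thesis using ups_y[OF 1 A(1) cA] blk_t[OF 1] cA True by (simp add: x'_def)
        next
          case 2
          then show ?thesis using wH[OF 2(2)] A(1) cA True by (simp add: x'_def H_def)
        qed
      qed
    qed
  qed
  then show ?thesis by blast
qed

lemma binomial_chains_exist: "3 * k \<le> n + 1 \<Longrightarrow> \<exists>r x. binomial_chains n k r x"
proof (induction k)
  case 0
  define r where "r s = (if s = 0 then 1 else 0 :: nat)" for s :: nat
  define x where "x b i A = (if A = {} then 1 else 0 :: int)" for b :: "nat \<times> nat" and i :: nat and A :: "nat set"
  have empty: "{} \<in> ballot n 0" by (rule ballot_full) auto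
  have blk: "blocks r 0 = {(0, 0)}" by (auto simp: blocks_def r_def)
  have fin: "finite A" if "A \<in> ballot n 0" for A
    using ballot_subset[OF that] finite_subset by blast
  have x: "x b 0 \<in> layer (ballot n 0) 0" for b using empty by (simp add: layer_def x_def)
  have span: "\<exists>c. v = (\<lambda>a. c (0, 0) * x (0, 0) 0 a)" if "v \<in> layer (ballot n 0) 0" for v
  proof (intro exI[of _ "\<lambda>_. v {}"] ext)
    fix a
    have "a = {}" if "v a \<noteq> 0"
      using that \<open>v \<in> layer (ballot n 0) 0\<close> fin[of a] unfolding layer_def by auto
    then show "v a = v {} * x (0, 0) 0 a" by (auto simp: x_def)
  qed
  have basis: "zbasis (blocks r 0) (\<lambda>b. x b 0) (layer (ballot n 0) 0)"
    unfolding zbasis_def blk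
  proof (intro conjI ballI allI impI)
    show "\<exists>c. v = (\<lambda>a. \<Sum>b\<in>{(0, 0)}. c b * x b 0 a)" if "v \<in> layer (ballot n 0) 0" for v
      using span[OF that] by simp
    fix c :: "nat \<times> nat \<Rightarrow> int" and b :: "nat \<times> nat"
    assume "\<forall>a. (\<Sum>b\<in>{(0, 0)}. c b * x b 0 a) = 0" "b \<in> {(0, 0)}"
    then show "c b = 0" by (auto simp: x_def dest: spec[of _ "{}"])
  qed (use x in simp_all)
  have "upsum n (x b 0) A = x b 0 A" if "A \<subseteq> {1..n}" "card A = 0" for A b
    using upsum_same[OF x that(2,1)] .
  then have "binomial_chains n 0 r x" unfolding binomial_chains_def using basis by (simp add: blk)
  then show ?case by blast
next
  case (Suc t)
  then obtain r x where "binomial_chains n t r x" by auto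
  then show ?case using binomial_chains_extend Suc.prems by blast
qed

lemma binomial_chains_card:
  assumes "binomial_chains n k r x" "i \<le> k"
  shows "(\<Sum>s\<le>i. r s) = card {J \<in> ballot n 0. card J = i}"
proof -
  have "zbasis (blocks r i) (\<lambda>b. x b i) (layer (ballot n 0) i)"
    using assms unfolding binomial_chains_def by blast
  then have "card (blocks r i) = card {J \<in> ballot n 0. card J = i}"
    using zbasis_card zbasis_layer[OF finite_ballot] by blast
  then show ?thesis by (simp add: blocks_def card_SigmaI)
qed

section \<open>The adjacency matrix on chains\<close>

lemma ibinom_nat [simp]: "ibinom (int a) (int b) = int (a choose b)"
  by (simp add: ibinom_def binomial_eq_0)

text \<open>Such a set is \<open>J\<close> together with a part of \<open>K - J\<close> and a part of the complement of \<open>K \<union> J\<close>, whose sizes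
are forced. When a forced size is negative there is no such set, and the corresponding \<^const>\<open>ibinom\<close>
vanishes.\<close>

lemma card_supersets_with_intersection:
  assumes K: "K \<subseteq> {1..n}" "card K = k" and J: "J \<subseteq> {1..n}" and lk: "l \<le> k"
  shows "int (card {K'. K' \<subseteq> {1..n} \<and> card K' = k \<and> J \<subseteq> K' \<and> card (K \<inter> K') = l}) =
    ibinom (int k - int (card (J \<inter> K))) (int l - int (card (J \<inter> K))) *
    ibinom (int n - int k - int (card J) + int (card (J \<inter> K)))
           (int k - int l - int (card J) + int (card (J \<inter> K)))"
proof -
  let ?S = "{K'. K' \<subseteq> {1..n} \<and> card K' = k \<and> J \<subseteq> K' \<and> card (K \<inter> K') = l}"
  define t i where "t = card (J \<inter> K)" and "i = card J"
  have fin: "finite K" "finite J" using K J finite_subset by blast+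
  have split_J: "i = t + card (J - K)"
    unfolding i_def t_def using card_Int_Diff[OF fin(2), of K] .
  have cKJ: "card (K - J) = k - t"
    using fin K(2) card_Diff_subset_Int[of K J] by (simp add: t_def Int_commute)
  have tk: "t \<le> k" unfolding t_def K(2)[symmetric] by (rule card_mono) (use fin in auto)
  have "card (K \<union> J) + t = k + i"
    using card_Un_Int[OF fin] by (simp add: t_def i_def K(2) Int_commute)
  moreover have "card (K \<union> J) \<le> n" using card_mono[of "{1..n}" "K \<union> J"] K J by simp
  ultimately have cKJ': "card (K \<union> J) = k + i - t" "k + i \<le> n + t" by auto
  have cC: "card ({1..n} - (K \<union> J)) = n - (k + i - t)"
    using K J fin cKJ' by (simp add: card_Diff_subset)
  have split: "l + card (K' - K) = k \<and> t \<le> l \<and> card (J - K) \<le> card (K' - K)" if "K' \<in> ?S" for K'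
  proof -
    have finK': "finite K'" using that finite_subset by blast
    have "k = l + card (K' - K)" using card_Int_Diff[OF finK', of K] that by (simp add: Int_commute)
    moreover have "t \<le> card (K \<inter> K')" unfolding t_def
      by (rule card_mono) (use fin that in auto)
    moreover have "card (J - K) \<le> card (K' - K)" by (rule card_mono) (use finK' that in auto)
    ultimately show ?thesis using that by simp
  qed
  show ?thesis
  proof (cases "t \<le> l \<and> l + i \<le> k + t")
    case True
    define p q where "p = l - t" and "q = k + t - (l + i)"
    let ?P = "{A. A \<subseteq> K - J \<and> card A = p}" and ?Q = "{A. A \<subseteq> {1..n} - (K \<union> J) \<and> card A = q}"
    have "bij_betw (\<lambda>K'. (K' \<inter> K - J, K' - K - J)) ?S (?P \<times> ?Q)"
    proof (rule bij_betw_byWitness[where f' = "\<lambda>(A, B). J \<union> A \<union> B"])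
      show "\<forall>K'\<in>?S. (case (K' \<inter> K - J, K' - K - J) of (A, B) \<Rightarrow> J \<union> A \<union> B) = K'" by auto
      show "\<forall>z\<in>?P \<times> ?Q. (\<lambda>K'. (K' \<inter> K - J, K' - K - J)) (case z of (A, B) \<Rightarrow> J \<union> A \<union> B) = z" by auto
      show "(\<lambda>K'. (K' \<inter> K - J, K' - K - J)) ` ?S \<subseteq> ?P \<times> ?Q"
      proof (rule image_subsetI)
        fix K' assume K': "K' \<in> ?S"
        have finK': "finite K'" using K' finite_subset by blast
        have "(K' \<inter> K) \<inter> J = J \<inter> K" using K' by auto
        then have 1: "card (K' \<inter> K - J) = p"
          using card_Diff_subset_Int[of "K' \<inter> K" J] fin K' by (simp add: p_def t_def Int_commute)
        have "(K' - K) \<inter> J = J - K" using K' by auto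
        then have "card (K' - K - J) = card (K' - K) - card (J - K)"
          using card_Diff_subset_Int[of "K' - K" J] fin by simp
        then have 2: "card (K' - K - J) = q"
          using split[OF K'] split_J unfolding q_def by linarith
        have "K' \<inter> K - J \<subseteq> K - J" "K' - K - J \<subseteq> {1..n} - (K \<union> J)" using K' by auto
        then show "(K' \<inter> K - J, K' - K - J) \<in> ?P \<times> ?Q" using 1 2 by simp
      qed
      show "(\<lambda>(A, B). J \<union> A \<union> B) ` (?P \<times> ?Q) \<subseteq> ?S"
      proof (rule image_subsetI, clarify)
        fix A B assume A: "A \<subseteq> K - J" "p = card A" and B: "B \<subseteq> {1..n} - (K \<union> J)" "q = card B"
        have finAB: "finite A" "finite B" using A(1) B(1) fin by (auto intro: finite_subset)
        have "card (J \<union> A \<union> B) = card (J \<union> A) + card B"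
          using A(1) B(1) fin finAB by (intro card_Un_disjoint) auto
        also have "card (J \<union> A) = card J + card A"
          using A(1) fin finAB by (intro card_Un_disjoint) auto
        finally have 1: "card (J \<union> A \<union> B) = k"
          using True A(2) B(2) unfolding p_def q_def i_def by linarith
        have "K \<inter> (J \<union> A \<union> B) = (J \<inter> K) \<union> A" using A(1) B(1) by auto
        also have "card \<dots> = card (J \<inter> K) + card A"
          using A(1) fin finAB by (intro card_Un_disjoint) auto
        finally have 2: "card (K \<inter> (J \<union> A \<union> B)) = l"
          using True A(2) unfolding p_def t_def by linarith
        have "J \<union> A \<union> B \<subseteq> {1..n}" using A(1) B(1) J K by auto
        then show "J \<union> A \<union> B \<subseteq> {1..n} \<and> card (J \<union> A \<union> B) = k \<and> J \<subseteq> J \<union> A \<union> B \<and>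
          card (K \<inter> (J \<union> A \<union> B)) = l" using 1 2 by blast
      qed
    qed
    then have "card ?S = card (?P \<times> ?Q)" by (rule bij_betw_same_card)
    also have "\<dots> = ((k - t) choose p) * ((n - (k + i - t)) choose q)"
    proof -
      have "card ?P = (k - t) choose p" using n_subsets[of "K - J" p] fin(1) unfolding cKJ by blast
      moreover have "card ?Q = (n - (k + i - t)) choose q"
        using n_subsets[of "{1..n} - (K \<union> J)" q] unfolding cC by blast
      ultimately show ?thesis unfolding card_cartesian_product by (simp only:)
    qed
    finally have "int (card ?S) = int ((k - t) choose p) * int ((n - (k + i - t)) choose q)" by simp
    moreover have "ibinom (int k - int t) (int l - int t) = int ((k - t) choose p)"
      unfolding ibinom_def p_def using True tk lk by (auto simp: nat_diff_distrib)
    moreover have "ibinom (int n - int k - int i + int t) (int k - int l - int i + int t)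
        = int ((n - (k + i - t)) choose q)"
    proof -
      have "int n - int k - int i + int t = int (n - (k + i - t))"
        "int k - int l - int i + int t = int q"
        using True cKJ' tk unfolding q_def by auto
      then show ?thesis by (simp only: ibinom_nat)
    qed
    ultimately show ?thesis by (simp add: t_def i_def)
  next
    case False
    have "K' \<notin> ?S" for K'
      using split[of K'] split_J False by linarith
    then have "?S = {}" by blast
    moreover have "int l - int t < 0 \<or> int k - int l - int i + int t < 0" using False by auto
    ultimately show ?thesis by (auto simp: ibinom_def t_def i_def)
  qed
qed

lemma binomial_inversion_sum:
  fixes g :: "nat \<Rightarrow> int"
  assumes "t \<le> i"
  shows "(\<Sum>u\<le>i. int (t choose u) * (\<Sum>v=0..u. (-1) ^ (u + v) * int (u choose v) * g v)) = g t"
proof -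
  have inner: "(\<Sum>u\<in>{v..i}. int (t choose u) * ((-1) ^ (u + v) * int (u choose v))) = (if v = t then 1 else 0)"
    if v: "v \<le> i" for v
  proof -
    have "(\<Sum>u\<in>{v..i}. int (t choose u) * ((-1) ^ (u + v) * int (u choose v)))
        = (\<Sum>u\<in>{v..t}. int (t choose u) * ((-1) ^ (u + v) * int (u choose v)))"
      using assms by (intro sum.mono_neutral_right) (auto simp: binomial_eq_0)
    also have "\<dots> = (\<Sum>u\<in>{v..t}. int (t choose v) * ((-1) ^ (u - v) * int ((t - v) choose (u - v))))"
    proof (rule sum.cong[OF refl])
      fix u assume u: "u \<in> {v..t}"
      then have "(t choose u) * (u choose v) = (t choose v) * ((t - v) choose (u - v))"
        by (intro choose_mult) auto
      then have "int (t choose u) * int (u choose v) = int (t choose v) * int ((t - v) choose (u - v))"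
        by (metis of_nat_mult)
      moreover have "(-1 :: int) ^ (u + v) = (-1) ^ (u - v)"
        using u by (simp add: minus_one_power_iff)
      ultimately show "int (t choose u) * ((-1) ^ (u + v) * int (u choose v))
          = int (t choose v) * ((-1) ^ (u - v) * int ((t - v) choose (u - v)))"
        by (simp add: mult.left_commute)
    qed
    also have "\<dots> = (if v = t then 1 else 0)"
    proof (cases "v < t")
      case True
      have "(\<Sum>u\<in>{v..t}. (-1) ^ (u - v) * int ((t - v) choose (u - v)))
          = (\<Sum>w\<le>t - v. (-1) ^ w * int ((t - v) choose w))"
        by (rule sum.reindex_bij_witness[where i = "\<lambda>w. w + v" and j = "\<lambda>u. u - v"]) (use True in auto)
      also have "\<dots> = 0" using choose_alternating_sum[of "t - v", where 'a = int] True by simp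
      finally show ?thesis using True by (simp add: sum_distrib_left[symmetric])
    qed (cases "v = t"; simp)
    finally show ?thesis .
  qed
  have "(\<Sum>u\<le>i. int (t choose u) * (\<Sum>v=0..u. (-1) ^ (u + v) * int (u choose v) * g v))
      = (\<Sum>u\<in>{0..i}. \<Sum>v\<in>{0..u}. int (t choose u) * ((-1) ^ (u + v) * int (u choose v)) * g v)"
    by (simp add: sum_distrib_left mult.assoc atMost_atLeast0)
  also have "\<dots> = (\<Sum>u\<in>{0..i}. \<Sum>v | v \<in> {0..i} \<and> v \<le> u. int (t choose u) * ((-1) ^ (u + v) * int (u choose v)) * g v)"
    by (intro sum.cong refl) auto
  also have "\<dots> = (\<Sum>v\<in>{0..i}. \<Sum>u | u \<in> {0..i} \<and> v \<le> u. int (t choose u) * ((-1) ^ (u + v) * int (u choose v)) * g v)"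
    by (rule sum.swap_restrict) auto
  also have "\<dots> = (\<Sum>v\<in>{0..i}. \<Sum>u\<in>{v..i}. int (t choose u) * ((-1) ^ (u + v) * int (u choose v)) * g v)"
    by (intro sum.cong refl) auto
  also have "\<dots> = (\<Sum>v\<in>{0..i}. (if v = t then 1 else 0) * g v)"
    by (intro sum.cong refl) (simp add: inner sum_distrib_right[symmetric])
  also have "\<dots> = (\<Sum>v\<in>{0..i}. if v = t then g v else 0)"
    by (intro sum.cong refl) simp
  also have "\<dots> = g t" using assms by simp
  finally show ?thesis .
qed

text \<open>The alternating sum that occurs in \<^const>\<open>M_entry\<close>.\<close>

definition transfer_coeff :: "nat \<Rightarrow> nat \<Rightarrow> nat \<Rightarrow> nat \<Rightarrow> nat \<Rightarrow> int" where
  "transfer_coeff n k l u j = (\<Sum>v = 0..u. (-1) ^ (u + v) * ibinom (int u) (int v)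
          * ibinom (int k - int v) (int l - int v)
          * ibinom (int n - int k - int j + int v) (int k - int l - int j + int v))"

text \<open>After exchanging summations, \<open>x J\<close> is weighted by the number of \<open>k\<close>-sets above \<open>J\<close> that meet \<open>K\<close> in \<open>l\<close>
points. By binomial inversion this number is a combination of the numbers \<open>|J \<inter> K| choose u\<close> of \<open>u\<close>-sets
contained in both \<open>J\<close> and \<open>K\<close>, and summing over \<open>J\<close> first turns these into superset sums of \<open>x\<close>.\<close>

lemma intersection_sum_downsum:
  assumes F: "F \<subseteq> Pow {1..n}" and x: "x \<in> layer F i" and K: "K \<subseteq> {1..n}" "card K = k" and lk: "l \<le> k"
  shows "(\<Sum>K' | K' \<subseteq> {1..n} \<and> card K' = k. (if card (K \<inter> K') = l then 1 else 0) * downsum x K')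
    = (\<Sum>u\<le>i. transfer_coeff n k l u i * (\<Sum>I | I \<subseteq> K \<and> card I = u. upsum n x I))"
proof -
  let ?U = "Pow {1..n}"
  let ?KK = "{K'. K' \<subseteq> {1..n} \<and> card K' = k}"
  define g where "g v = ibinom (int k - int v) (int l - int v)
          * ibinom (int n - int k - int i + int v) (int k - int l - int i + int v)" for v
  have finKK: "finite ?KK" by (rule finite_subset[of _ ?U]) auto
  have finK: "finite K" using K finite_subset by blast
  have "(\<Sum>K'\<in>?KK. (if card (K \<inter> K') = l then 1 else 0) * downsum x K')
      = (\<Sum>K'\<in>?KK. \<Sum>J\<in>?U. if J \<subseteq> K' \<and> card (K \<inter> K') = l then x J else 0)"
  proof (rule sum.cong[OF refl])
    fix K' assume "K' \<in> ?KK"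
    then have "{J \<in> ?U. J \<subseteq> K'} = Pow K'" by auto
    then have "(\<Sum>J\<in>?U. if J \<subseteq> K' then x J else 0) = downsum x K'"
      unfolding downsum_def by (subst sum.inter_filter[symmetric]) auto
    then show "(if card (K \<inter> K') = l then 1 else 0) * downsum x K'
        = (\<Sum>J\<in>?U. if J \<subseteq> K' \<and> card (K \<inter> K') = l then x J else 0)" by auto
  qed
  also have "\<dots> = (\<Sum>J\<in>?U. \<Sum>K'\<in>?KK. if J \<subseteq> K' \<and> card (K \<inter> K') = l then x J else 0)"
    by (rule sum.swap)
  also have "\<dots> = (\<Sum>J\<in>?U. \<Sum>u\<le>i. transfer_coeff n k l u i * (\<Sum>I | I \<subseteq> K \<and> card I = u. if I \<subseteq> J then x J else 0))"
  proof (rule sum.cong[OF refl])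
    fix J assume J: "J \<in> ?U"
    show "(\<Sum>K'\<in>?KK. if J \<subseteq> K' \<and> card (K \<inter> K') = l then x J else 0)
      = (\<Sum>u\<le>i. transfer_coeff n k l u i * (\<Sum>I | I \<subseteq> K \<and> card I = u. if I \<subseteq> J then x J else 0))"
    proof (cases "x J = 0")
      case False
      then have cJ: "card J = i" using x unfolding layer_def by blast
      have finJ: "finite J" using J finite_subset by blast
      define t where "t = card (J \<inter> K)"
      have t: "t \<le> i" unfolding t_def cJ[symmetric] by (rule card_mono) (use finJ in auto)
      have "{K' \<in> ?KK. J \<subseteq> K' \<and> card (K \<inter> K') = l}
          = {K'. K' \<subseteq> {1..n} \<and> card K' = k \<and> J \<subseteq> K' \<and> card (K \<inter> K') = l}" by auto
      then have "(\<Sum>K'\<in>?KK. if J \<subseteq> K' \<and> card (K \<inter> K') = l then x J else 0) = g t * x J"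
        using card_supersets_with_intersection[OF K, of J l] J lk finKK
        by (subst sum.inter_filter[symmetric]) (auto simp: g_def t_def cJ)
      also have "g t = (\<Sum>u\<le>i. int (t choose u) * transfer_coeff n k l u i)"
        using binomial_inversion_sum[OF t, of g]
        by (simp add: transfer_coeff_def g_def mult.assoc)
      also have "\<dots> * x J = (\<Sum>u\<le>i. transfer_coeff n k l u i * (int (t choose u) * x J))"
        unfolding sum_distrib_right by (intro sum.cong refl) (simp add: ac_simps)
      also have "\<dots> = (\<Sum>u\<le>i. transfer_coeff n k l u i * (\<Sum>I | I \<subseteq> K \<and> card I = u. if I \<subseteq> J then x J else 0))"
      proof (rule sum.cong[OF refl])
        fix u
        have "{I \<in> {I. I \<subseteq> K \<and> card I = u}. I \<subseteq> J} = {I. I \<subseteq> J \<inter> K \<and> card I = u}" by auto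
        then have "(\<Sum>I | I \<subseteq> K \<and> card I = u. if I \<subseteq> J then x J else 0) = int (t choose u) * x J"
          using finK finJ n_subsets[of "J \<inter> K" u]
          by (subst sum.inter_filter[symmetric]) (auto simp: t_def intro: finite_subset[of _ "Pow K"])
        then show "transfer_coeff n k l u i * (int (t choose u) * x J)
          = transfer_coeff n k l u i * (\<Sum>I | I \<subseteq> K \<and> card I = u. if I \<subseteq> J then x J else 0)" by simp
      qed
      finally show ?thesis .
    qed (simp cong: if_cong)
  qed
  also have "\<dots> = (\<Sum>u\<le>i. \<Sum>J\<in>?U. transfer_coeff n k l u i * (\<Sum>I | I \<subseteq> K \<and> card I = u. if I \<subseteq> J then x J else 0))"
    by (rule sum.swap)
  also have "\<dots> = (\<Sum>u\<le>i. transfer_coeff n k l u i * (\<Sum>I | I \<subseteq> K \<and> card I = u. upsum n x I))"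
  proof (rule sum.cong[OF refl])
    fix u
    have "(\<Sum>J\<in>?U. \<Sum>I | I \<subseteq> K \<and> card I = u. if I \<subseteq> J then x J else 0)
        = (\<Sum>I | I \<subseteq> K \<and> card I = u. \<Sum>J\<in>?U. if I \<subseteq> J then x J else 0)" by (rule sum.swap)
    also have "\<dots> = (\<Sum>I | I \<subseteq> K \<and> card I = u. upsum n x I)"
    proof (rule sum.cong[OF refl])
      fix I
      have "{J \<in> ?U. I \<subseteq> J} = {J. I \<subseteq> J \<and> J \<subseteq> {1..n}}" by auto
      then show "(\<Sum>J\<in>?U. if I \<subseteq> J then x J else 0) = upsum n x I"
        unfolding upsum_def by (subst sum.inter_filter[symmetric]) auto
    qed
    finally show "(\<Sum>J\<in>?U. transfer_coeff n k l u i * (\<Sum>I | I \<subseteq> K \<and> card I = u. if I \<subseteq> J then x J else 0))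
      = transfer_coeff n k l u i * (\<Sum>I | I \<subseteq> K \<and> card I = u. upsum n x I)"
      by (simp add: sum_distrib_left[symmetric])
  qed
  finally show ?thesis .
qed

lemma binomial_chain_action:
  assumes ch: "binomial_chains n k r x" and b: "b \<in> blocks r i" and ik: "i \<le> k"
    and K: "K \<subseteq> {1..n}" "card K = k" and lk: "l \<le> k"
  shows "(\<Sum>K' | K' \<subseteq> {1..n} \<and> card K' = k. (if card (K \<inter> K') = l then 1 else 0) * downsum (x b i) K')
      - lam * downsum (x b i) K
    = (\<Sum>u\<in>{fst b..k}. M_entry n k l lam (fst b) u i * downsum (x b u) K)"
proof -
  define s where "s = fst b"
  have si: "s \<le> i" using b by (auto simp: blocks_def s_def)
  have F: "ballot n 0 \<subseteq> Pow {1..n}" using ballot_subset by auto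
  have finK: "finite K" using K finite_subset by blast
  have mem: "x b u \<in> layer (ballot n 0) u" if "s \<le> u" "u \<le> k" for u
  proof -
    have "b \<in> blocks r u" using b that by (auto simp: blocks_def s_def)
    moreover have "zbasis (blocks r u) (\<lambda>b. x b u) (layer (ballot n 0) u)"
      using ch that(2) unfolding binomial_chains_def by blast
    ultimately show ?thesis using zbasis_mem by fastforce
  qed
  have ups: "(\<Sum>I | I \<subseteq> K \<and> card I = u. upsum n (x b i) I)
      = (if s \<le> u then int ((i - s) choose (u - s)) * downsum (x b u) K else 0)" if u: "u \<le> i" for u
  proof -
    have "upsum n (x b i) I = (if s \<le> u then int ((i - s) choose (u - s)) * x b u I else 0)"
      if "I \<subseteq> K" "card I = u" for I
    proof -
      have "I \<subseteq> {1..n}" "card I \<le> i" using that K u by auto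
      then show ?thesis using ch b ik that(2) unfolding binomial_chains_def s_def by blast
    qed
    then have "(\<Sum>I | I \<subseteq> K \<and> card I = u. upsum n (x b i) I)
        = (if s \<le> u then int ((i - s) choose (u - s)) * (\<Sum>I | I \<subseteq> K \<and> card I = u. x b u I) else 0)"
      by (simp add: sum_distrib_left)
    moreover have "(\<Sum>I | I \<subseteq> K \<and> card I = u. x b u I) = downsum (x b u) K" if "s \<le> u"
      unfolding downsum_def using mem[OF that] u ik finK
      by (intro sum.mono_neutral_left) (auto simp: layer_def)
    ultimately show ?thesis by simp
  qed
  have "(\<Sum>K' | K' \<subseteq> {1..n} \<and> card K' = k. (if card (K \<inter> K') = l then 1 else 0) * downsum (x b i) K')
      = (\<Sum>u\<le>i. if s \<le> u then transfer_coeff n k l u i * (int ((i - s) choose (u - s)) * downsum (x b u) K) else 0)"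
    unfolding intersection_sum_downsum[OF F mem[OF si ik] K lk] using ups by (intro sum.cong) auto
  also have "\<dots> = (\<Sum>u\<in>{s..i}. transfer_coeff n k l u i * (int ((i - s) choose (u - s)) * downsum (x b u) K))"
    by (subst sum.inter_filter[symmetric]) (auto intro!: sum.cong)
  also have "\<dots> = (\<Sum>u\<in>{s..k}. transfer_coeff n k l u i * (int ((i - s) choose (u - s)) * downsum (x b u) K))"
  proof (rule sum.mono_neutral_left)
    have "(i - s) choose (u - s) = 0" if "u \<in> {s..k} - {s..i}" for u
      using that si by (intro binomial_eq_0) auto
    then show "\<forall>u\<in>{s..k} - {s..i}.
        transfer_coeff n k l u i * (int ((i - s) choose (u - s)) * downsum (x b u) K) = 0" by simp
  qed (use ik in auto)
  finally have 1: "(\<Sum>K' | K' \<subseteq> {1..n} \<and> card K' = k. (if card (K \<inter> K') = l then 1 else 0) * downsum (x b i) K') = \<dots>" .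
  have 2: "lam * downsum (x b i) K = (\<Sum>u\<in>{s..k}. if u = i then lam * downsum (x b u) K else 0)"
    using si ik by simp
  have "M_entry n k l lam s u i * downsum (x b u) K
      = transfer_coeff n k l u i * (int ((i - s) choose (u - s)) * downsum (x b u) K)
        - (if u = i then lam * downsum (x b u) K else 0)" if "u \<in> {s..k}" for u
  proof -
    have "ibinom (int i - int s) (int u - int s) = int ((i - s) choose (u - s))"
      using that si ibinom_nat[of "i - s" "u - s"] by (simp add: of_nat_diff)
    then show ?thesis unfolding M_entry_def transfer_coeff_def by (simp add: algebra_simps)
  qed
  then show ?thesis unfolding 1 2 s_def[symmetric] sum_subtractf[symmetric] by (intro sum.cong) auto
qed

section \<open>Block-diagonal matrices along an enumeration\<close>

text \<open>The determinant of \<open>A\<close> is a unit, so the adjugate of \<open>A\<close> is a nonzero multiple of \<open>B\<close>, and the adjugate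
commutes with \<open>A\<close>.\<close>

lemma int_mat_right_inverse_imp_left_inverse:
  fixes A B :: "int mat"
  assumes A: "A \<in> carrier_mat n n" and B: "B \<in> carrier_mat n n" and AB: "A * B = 1\<^sub>m n"
  shows "B * A = 1\<^sub>m n"
proof -
  have "det A * det B = 1" using det_mult[OF A B] AB by simp
  then have nz: "det A \<noteq> 0" by auto
  have adj: "adj_mat A \<in> carrier_mat n n" "adj_mat A * A = det A \<cdot>\<^sub>m 1\<^sub>m n" using adj_mat[OF A] by auto
  have "adj_mat A = adj_mat A * (A * B)" using AB adj(1) by simp
  also have "\<dots> = (adj_mat A * A) * B" using A B adj(1) by (simp add: assoc_mult_mat)
  also have "\<dots> = det A \<cdot>\<^sub>m B" unfolding adj(2) using B by (simp add: mult_smult_assoc_mat[of _ n n _ n])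
  finally have "det A \<cdot>\<^sub>m (B * A) = det A \<cdot>\<^sub>m 1\<^sub>m n" using adj(2) A B
    by (simp add: mult_smult_assoc_mat[of _ n n _ n])
  then have eq: "(det A \<cdot>\<^sub>m (B * A)) $$ (i, j) = (det A \<cdot>\<^sub>m 1\<^sub>m n) $$ (i, j)" for i j by simp
  show ?thesis
  proof (rule eq_matI)
    fix i j assume ij: "i < dim_row (1\<^sub>m n :: int mat)" "j < dim_col (1\<^sub>m n :: int mat)"
    then have "det A * (B * A) $$ (i, j) = det A * 1\<^sub>m n $$ (i, j)"
      using eq[of i j] A B by (simp del: index_mult_mat(1))
    then show "(B * A) $$ (i, j) = 1\<^sub>m n $$ (i, j)" using nz by simp
  qed (use A B in auto)
qed

lemma invertible_matI:
  assumes "A \<in> carrier_mat n n" "B \<in> carrier_mat n n" "A * B = 1\<^sub>m n" "B * A = 1\<^sub>m n"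
  shows "invertible_mat A"
  using assms unfolding invertible_mat_def inverts_mat_def by auto

lemma invertible_matE:
  assumes "invertible_mat A" "A \<in> carrier_mat n n"
  obtains B where "B \<in> carrier_mat n n" "A * B = 1\<^sub>m n" "B * A = 1\<^sub>m n"
proof -
  obtain B where B: "A * B = 1\<^sub>m (dim_row A)" "B * A = 1\<^sub>m (dim_row B)"
    using assms unfolding invertible_mat_def inverts_mat_def by auto
  have "dim_col (A * B) = n" "dim_col (B * A) = dim_row B" using B assms(2) by auto
  then have "B \<in> carrier_mat n n" using assms(2) by auto
  then show thesis using that B assms(2) by auto
qed

text \<open>The block structure of a matrix with rows and columns \<open>0, \<dots>, N - 1\<close>: the index \<open>p\<close> is the row or column
\<open>snd (\<sigma> p)\<close> of the block \<open>fst (\<sigma> p)\<close>. Blocks carry labels from \<open>B\<close> and need not occupy consecutive indices, so any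
enumeration of the pairs (label, position) serves.\<close>

locale block_indexing =
  fixes N :: nat and B :: "'b set" and d :: "'b \<Rightarrow> nat" and \<sigma> :: "nat \<Rightarrow> 'b \<times> nat"
  assumes finite_B: "finite B" and bij: "bij_betw \<sigma> {..<N} (SIGMA b:B. {..<d b})"
begin

definition pos :: "'b \<Rightarrow> nat \<Rightarrow> nat" where
  "pos b i = the_inv_into {..<N} \<sigma> (b, i)"

definition block_mat :: "('b \<Rightarrow> int mat) \<Rightarrow> int mat" where
  "block_mat M = mat N N (\<lambda>(p, q).
     if fst (\<sigma> p) = fst (\<sigma> q) then M (fst (\<sigma> p)) $$ (snd (\<sigma> p), snd (\<sigma> q)) else 0)"

definition block_vec :: "'b \<Rightarrow> int vec \<Rightarrow> int vec" where
  "block_vec b w = vec (d b) (\<lambda>i. w $ pos b i)"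

lemma pos_less: "b \<in> B \<Longrightarrow> i < d b \<Longrightarrow> pos b i < N"
  and sigma_pos: "b \<in> B \<Longrightarrow> i < d b \<Longrightarrow> \<sigma> (pos b i) = (b, i)"
proof -
  assume "b \<in> B" "i < d b"
  then have "(b, i) \<in> \<sigma> ` {..<N}" using bij by (simp add: bij_betw_def)
  moreover have "inj_on \<sigma> {..<N}" using bij by (simp add: bij_betw_def)
  ultimately show "pos b i < N" "\<sigma> (pos b i) = (b, i)"
    unfolding pos_def using the_inv_into_into[of \<sigma> "{..<N}" "(b, i)" "{..<N}"]
    by (auto simp: f_the_inv_into_f)
qed

lemma sigma_mem: "p < N \<Longrightarrow> fst (\<sigma> p) \<in> B" "p < N \<Longrightarrow> snd (\<sigma> p) < d (fst (\<sigma> p))"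
proof -
  assume "p < N"
  then have "\<sigma> p \<in> (SIGMA b:B. {..<d b})" using bij by (auto simp: bij_betw_def)
  then show "fst (\<sigma> p) \<in> B" "snd (\<sigma> p) < d (fst (\<sigma> p))" by auto
qed

lemma pos_sigma: "p < N \<Longrightarrow> pos (fst (\<sigma> p)) (snd (\<sigma> p)) = p"
  unfolding pos_def using bij by (simp add: bij_betw_def the_inv_into_f_f)

lemma sum_positions: "(\<Sum>p<N. f p) = (\<Sum>b\<in>B. \<Sum>i<d b. f (pos b i))"
proof -
  have "(\<Sum>p<N. f p) = (\<Sum>p<N. (\<lambda>(b, i). f (pos b i)) (\<sigma> p))"
    by (intro sum.cong) (auto simp: pos_sigma split_beta)
  also have "\<dots> = (\<Sum>z\<in>(SIGMA b:B. {..<d b}). (\<lambda>(b, i). f (pos b i)) z)"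
    using sum.reindex_bij_betw[OF bij] .
  also have "\<dots> = (\<Sum>b\<in>B. \<Sum>i<d b. f (pos b i))"
    using sum.Sigma[OF finite_B, of "\<lambda>b. {..<d b}" "\<lambda>b i. f (pos b i)"] by simp
  finally show ?thesis .
qed

lemma block_mat_carrier [simp]: "block_mat M \<in> carrier_mat N N"
  and block_mat_dim [simp]: "dim_row (block_mat M) = N" "dim_col (block_mat M) = N"
  by (simp_all add: block_mat_def)

lemma sum_one_block:
  assumes "c \<in> B"
  shows "(\<Sum>p<N. if fst (\<sigma> p) = c then f p else 0) = (\<Sum>i<d c. f (pos c i) :: int)"
proof -
  have "(\<Sum>p<N. if fst (\<sigma> p) = c then f p else 0)
      = (\<Sum>b\<in>B. \<Sum>i<d b. if b = c then f (pos b i) else 0)"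
    unfolding sum_positions by (intro sum.cong) (auto simp: sigma_pos)
  also have "\<dots> = (\<Sum>b\<in>B. if b = c then (\<Sum>i<d c. f (pos c i)) else 0)"
    by (intro sum.cong) auto
  also have "\<dots> = (\<Sum>i<d c. f (pos c i))" using finite_B assms by simp
  finally show ?thesis .
qed

lemma mult_index:
  assumes "A \<in> carrier_mat m r" "C \<in> carrier_mat r c" "i < m" "j < c"
  shows "(A * C) $$ (i, j) = (\<Sum>p<r. A $$ (i, p) * C $$ (p, j))"
  using assms by (simp add: scalar_prod_def atLeast0LessThan)

lemma mult_vec_index:
  assumes "A \<in> carrier_mat m r" "v \<in> carrier_vec r" "i < m"
  shows "(A *\<^sub>v v) $ i = (\<Sum>p<r. A $$ (i, p) * v $ p)"
  using assms by (simp add: scalar_prod_def atLeast0LessThan)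

lemma block_mat_mult:
  assumes "\<And>b. b \<in> B \<Longrightarrow> M b \<in> carrier_mat (d b) (d b)" "\<And>b. b \<in> B \<Longrightarrow> M' b \<in> carrier_mat (d b) (d b)"
  shows "block_mat M * block_mat M' = block_mat (\<lambda>b. M b * M' b)"
proof (rule eq_matI)
  fix p q assume "p < dim_row (block_mat (\<lambda>b. M b * M' b))" "q < dim_col (block_mat (\<lambda>b. M b * M' b))"
  then have pq: "p < N" "q < N" by auto
  define b where "b = fst (\<sigma> p)"
  have b: "b \<in> B" "snd (\<sigma> p) < d b" using sigma_mem[OF pq(1)] by (auto simp: b_def)
  have "(block_mat M * block_mat M') $$ (p, q)
      = (\<Sum>r<N. block_mat M $$ (p, r) * block_mat M' $$ (r, q))"
    by (rule mult_index) (use pq in auto)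
  also have "\<dots> = (\<Sum>r<N. if fst (\<sigma> r) = b then M b $$ (snd (\<sigma> p), snd (\<sigma> r)) *
      (if b = fst (\<sigma> q) then M' b $$ (snd (\<sigma> r), snd (\<sigma> q)) else 0) else 0)"
    using pq by (intro sum.cong) (auto simp: block_mat_def b_def)
  also have "\<dots> = (\<Sum>i<d b. M b $$ (snd (\<sigma> p), i) *
      (if b = fst (\<sigma> q) then M' b $$ (i, snd (\<sigma> q)) else 0))"
    unfolding sum_one_block[OF b(1)]
    by (intro sum.cong refl) (simp only: lessThan_iff sigma_pos[OF b(1)] snd_conv)
  also have "\<dots> = block_mat (\<lambda>b. M b * M' b) $$ (p, q)"
  proof (cases "b = fst (\<sigma> q)")
    case True
    then have "snd (\<sigma> q) < d b" using sigma_mem[OF pq(2)] by simp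
    then show ?thesis using True pq b mult_index[OF assms(1)[OF b(1)] assms(2)[OF b(1)] b(2)]
      by (simp add: block_mat_def b_def)
  next
    case False
    then show ?thesis using pq by (simp add: block_mat_def b_def)
  qed
  finally show "(block_mat M * block_mat M') $$ (p, q) = block_mat (\<lambda>b. M b * M' b) $$ (p, q)" .
qed auto

lemma block_mat_cong: "(\<And>b. b \<in> B \<Longrightarrow> M b = M' b) \<Longrightarrow> block_mat M = block_mat M'"
  unfolding block_mat_def by (intro cong_mat) (auto simp: sigma_mem)

lemma block_mat_one: "block_mat (\<lambda>b. 1\<^sub>m (d b)) = 1\<^sub>m N"
proof (rule eq_matI)
  fix p q assume "p < dim_row (1\<^sub>m N :: int mat)" "q < dim_col (1\<^sub>m N :: int mat)"
  then have pq: "p < N" "q < N" by auto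
  have "p = q" if "fst (\<sigma> p) = fst (\<sigma> q)" "snd (\<sigma> p) = snd (\<sigma> q)"
    using pos_sigma[OF pq(1)] pos_sigma[OF pq(2)] that by metis
  then show "block_mat (\<lambda>b. 1\<^sub>m (d b)) $$ (p, q) = 1\<^sub>m N $$ (p, q)"
    using pq sigma_mem(2)[OF pq(1)] sigma_mem(2)[OF pq(2)] by (auto simp: block_mat_def)
qed auto

lemma block_mat_invertible:
  assumes "\<And>b. b \<in> B \<Longrightarrow> M b \<in> carrier_mat (d b) (d b)" "\<And>b. b \<in> B \<Longrightarrow> invertible_mat (M b)"
  obtains R where "R \<in> carrier_mat N N" "block_mat M * R = 1\<^sub>m N" "R * block_mat M = 1\<^sub>m N"
proof -
  have "\<forall>b\<in>B. \<exists>R. R \<in> carrier_mat (d b) (d b) \<and> M b * R = 1\<^sub>m (d b) \<and> R * M b = 1\<^sub>m (d b)"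
    using assms by (meson invertible_matE)
  then obtain R where R: "\<And>b. b \<in> B \<Longrightarrow> R b \<in> carrier_mat (d b) (d b)"
    "\<And>b. b \<in> B \<Longrightarrow> M b * R b = 1\<^sub>m (d b)" "\<And>b. b \<in> B \<Longrightarrow> R b * M b = 1\<^sub>m (d b)"
    by metis
  have "block_mat M * block_mat R = block_mat (\<lambda>b. M b * R b)"
    using assms(1) R(1) by (rule block_mat_mult)
  also have "\<dots> = 1\<^sub>m N"
    unfolding block_mat_one[symmetric] using R(2) by (rule block_mat_cong)
  finally have 1: "block_mat M * block_mat R = 1\<^sub>m N" .
  have "block_mat R * block_mat M = block_mat (\<lambda>b. R b * M b)"
    using R(1) assms(1) by (rule block_mat_mult)
  also have "\<dots> = 1\<^sub>m N"
    unfolding block_mat_one[symmetric] using R(3) by (rule block_mat_cong)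
  finally have 2: "block_mat R * block_mat M = 1\<^sub>m N" .
  show thesis by (rule that[OF _ 1 2]) simp
qed

lemma block_mat_diagonal:
  assumes "\<And>b. b \<in> B \<Longrightarrow> D b \<in> carrier_mat (d b) (d b)" "\<And>b. b \<in> B \<Longrightarrow> diagonal_mat (D b)"
  shows "diagonal_mat (block_mat D)"
  unfolding diagonal_mat_def
proof (intro allI impI)
  fix p q assume "p < dim_row (block_mat D)" "q < dim_col (block_mat D)" and neq: "p \<noteq> q"
  then have pq: "p < N" "q < N" by auto
  show "block_mat D $$ (p, q) = 0"
  proof (cases "fst (\<sigma> p) = fst (\<sigma> q)")
    case True
    then have "snd (\<sigma> p) \<noteq> snd (\<sigma> q)" using pos_sigma[OF pq(1)] pos_sigma[OF pq(2)] neq by metis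
    then show ?thesis using assms[OF sigma_mem(1)[OF pq(1)]] sigma_mem[OF pq(1)] sigma_mem[OF pq(2)] pq True
      unfolding diagonal_mat_def by (auto simp: block_mat_def)
  qed (use pq in \<open>simp add: block_mat_def\<close>)
qed

lemma diag_entries_sum: "diag_entries A = (\<Sum>p<dim_row A. {#A $$ (p, p)#})"
proof -
  have "mset (map f [0..<m]) = (\<Sum>p<m. {#f p#})" for f :: "nat \<Rightarrow> int" and m
    by (induction m) auto
  then show ?thesis by (simp add: diag_entries_def diag_mat_def)
qed

lemma diag_entries_block_mat:
  assumes "\<And>b. b \<in> B \<Longrightarrow> D b \<in> carrier_mat (d b) (d b)"
  shows "diag_entries (block_mat D) = (\<Sum>b\<in>B. diag_entries (D b))"
proof -
  have "diag_entries (block_mat D) = (\<Sum>b\<in>B. \<Sum>i<d b. {#block_mat D $$ (pos b i, pos b i)#})"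
    unfolding diag_entries_sum by (simp add: sum_positions)
  also have "\<dots> = (\<Sum>b\<in>B. diag_entries (D b))"
  proof (rule sum.cong[OF refl])
    fix b assume b: "b \<in> B"
    then have "dim_row (D b) = d b" using assms by auto
    then show "(\<Sum>i<d b. {#block_mat D $$ (pos b i, pos b i)#}) = diag_entries (D b)"
      using b by (simp add: diag_entries_sum block_mat_def pos_less sigma_pos)
  qed
  finally show ?thesis .
qed

text \<open>If \<open>E b * M b * F b = D b\<close> for each block, then the block-diagonal matrices of \<open>E\<close> and \<open>F\<close>, combined with the
conjugation by \<open>P\<close>, bring \<open>L\<close> to the block-diagonal matrix of \<open>D\<close>.\<close>

lemma is_diagonal_form_block_similar:
  assumes L: "L \<in> carrier_mat N N" and P: "P \<in> carrier_mat N N" and Q: "Q \<in> carrier_mat N N"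
    and PQ: "P * Q = 1\<^sub>m N" and QP: "Q * P = 1\<^sub>m N" and sim: "L * P = P * block_mat M"
    and M: "\<And>b. b \<in> B \<Longrightarrow> M b \<in> carrier_mat (d b) (d b)"
    and D: "\<And>b. b \<in> B \<Longrightarrow> is_diagonal_form (M b) (D b)"
  shows "is_diagonal_form L (block_mat D)"
proof -
  have "\<exists>E F. E \<in> carrier_mat (d b) (d b) \<and> invertible_mat E \<and>
      F \<in> carrier_mat (d b) (d b) \<and> invertible_mat F \<and> E * M b * F = D b" if "b \<in> B" for b
    using D[OF that] carrier_matD[OF M[OF that]] unfolding is_diagonal_form_def by simp
  then obtain E F where EF: "\<And>b. b \<in> B \<Longrightarrow> E b \<in> carrier_mat (d b) (d b) \<and> invertible_mat (E b) \<and>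
      F b \<in> carrier_mat (d b) (d b) \<and> invertible_mat (F b) \<and> E b * M b * F b = D b" by metis
  then have E: "\<And>b. b \<in> B \<Longrightarrow> E b \<in> carrier_mat (d b) (d b)" "\<And>b. b \<in> B \<Longrightarrow> invertible_mat (E b)"
    and F: "\<And>b. b \<in> B \<Longrightarrow> F b \<in> carrier_mat (d b) (d b)" "\<And>b. b \<in> B \<Longrightarrow> invertible_mat (F b)"
    and EMF: "\<And>b. b \<in> B \<Longrightarrow> E b * M b * F b = D b" by blast+
  have Dc: "D b \<in> carrier_mat (d b) (d b)" "diagonal_mat (D b)" if "b \<in> B" for b
    using D[OF that] M[OF that] unfolding is_diagonal_form_def by auto
  obtain E' where E': "E' \<in> carrier_mat N N" "block_mat E * E' = 1\<^sub>m N" "E' * block_mat E = 1\<^sub>m N"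
    using block_mat_invertible E by blast
  obtain F' where F': "F' \<in> carrier_mat N N" "block_mat F * F' = 1\<^sub>m N" "F' * block_mat F = 1\<^sub>m N"
    using block_mat_invertible F by blast
  have cancel: "X * Y * (Y' * X') = 1\<^sub>m N"
    if "X \<in> carrier_mat N N" "Y \<in> carrier_mat N N" "X' \<in> carrier_mat N N" "Y' \<in> carrier_mat N N"
      "Y * Y' = 1\<^sub>m N" "X * X' = 1\<^sub>m N" for X Y X' Y' :: "int mat"
  proof -
    have "X * Y * (Y' * X') = X * (Y * Y') * X'"
      using that(1-4) by (simp add: assoc_mult_mat[of _ N N _ N _ N])
    then show ?thesis using that by simp
  qed
  let ?E = "block_mat E * Q" and ?F = "P * block_mat F"
  have inv: "invertible_mat ?E" "invertible_mat ?F"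
    by (rule invertible_matI[of _ N "P * E'"], use P Q PQ QP E' in \<open>auto intro!: cancel\<close>)
      (rule invertible_matI[of _ N "F' * Q"], use P Q PQ QP F' in \<open>auto intro!: cancel\<close>)
  have "?E * L * ?F = block_mat E * (Q * (L * P) * block_mat F)"
    using P Q L by (simp add: assoc_mult_mat[of _ N N _ N _ N])
  also have "Q * (L * P) = block_mat M"
    unfolding sim using P Q QP by (simp add: assoc_mult_mat[of _ N N _ N _ N, symmetric])
  also have "block_mat E * (block_mat M * block_mat F) = block_mat E * block_mat M * block_mat F"
    by (simp add: assoc_mult_mat[of _ N N _ N _ N])
  also have "\<dots> = block_mat (\<lambda>b. E b * M b * F b)"
  proof -
    have "block_mat E * block_mat M = block_mat (\<lambda>b. E b * M b)"
      using E(1) M by (rule block_mat_mult)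
    moreover have "E b * M b \<in> carrier_mat (d b) (d b)" if "b \<in> B" for b
      using E(1)[OF that] M[OF that] by (rule mult_carrier_mat)
    then have "block_mat (\<lambda>b. E b * M b) * block_mat F = block_mat (\<lambda>b. E b * M b * F b)"
      using F(1) by (rule block_mat_mult)
    ultimately show ?thesis by simp
  qed
  also have "\<dots> = block_mat D" using EMF by (rule block_mat_cong)
  finally have "?E * L * ?F = block_mat D" .
  moreover have "?E \<in> carrier_mat N N" "?F \<in> carrier_mat N N" using P Q by auto
  ultimately have "\<exists>E F. E \<in> carrier_mat N N \<and> invertible_mat E \<and> F \<in> carrier_mat N N \<and>
      invertible_mat F \<and> E * L * F = block_mat D"
    using inv by blast
  moreover have "diagonal_mat (block_mat D)" using Dc by (rule block_mat_diagonal)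
  ultimately show ?thesis
    unfolding is_diagonal_form_def carrier_matD[OF L] by simp
qed

lemma block_vec_carrier [simp]: "block_vec b w \<in> carrier_vec (d b)"
  by (simp add: block_vec_def)

lemma block_vec_transpose_mult:
  assumes b: "b \<in> B" and M: "M b \<in> carrier_mat (d b) (d b)" and c: "c \<in> carrier_vec N"
  shows "block_vec b (transpose_mat (block_mat M) *\<^sub>v c) = transpose_mat (M b) *\<^sub>v block_vec b c"
proof (rule eq_vecI)
  fix i assume "i < dim_vec (transpose_mat (M b) *\<^sub>v block_vec b c)"
  then have i: "i < d b" using M by simp
  have p: "pos b i < N" using pos_less b i .
  have "(transpose_mat (block_mat M) *\<^sub>v c) $ pos b i
      = (\<Sum>r<N. transpose_mat (block_mat M) $$ (pos b i, r) * c $ r)"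
    by (rule mult_vec_index) (use c p in auto)
  also have "\<dots> = (\<Sum>r<N. if fst (\<sigma> r) = b then M b $$ (snd (\<sigma> r), i) * c $ r else 0)"
    using p b i by (intro sum.cong) (auto simp: block_mat_def sigma_pos)
  also have "\<dots> = (\<Sum>i'<d b. M b $$ (i', i) * c $ pos b i')"
    unfolding sum_one_block[OF b] using b by (intro sum.cong) (auto simp: sigma_pos)
  also have "\<dots> = (\<Sum>i'<d b. transpose_mat (M b) $$ (i, i') * block_vec b c $ i')"
    using M i by (intro sum.cong) (auto simp: block_vec_def)
  also have "\<dots> = (transpose_mat (M b) *\<^sub>v block_vec b c) $ i"
    by (rule mult_vec_index[symmetric]) (use M i in auto)
  finally show "block_vec b (transpose_mat (block_mat M) *\<^sub>v c) $ i
      = (transpose_mat (M b) *\<^sub>v block_vec b c) $ i" using i by (simp add: block_vec_def)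
qed (use M in \<open>simp add: block_vec_def\<close>)

lemma block_vec_add:
  assumes "b \<in> B" "v \<in> carrier_vec N" "w \<in> carrier_vec N"
  shows "block_vec b (v + w) = block_vec b v + block_vec b w"
  using assms by (intro eq_vecI) (auto simp: block_vec_def pos_less)

lemma block_vec_ext:
  assumes "v \<in> carrier_vec N" "w \<in> carrier_vec N" "\<And>b. b \<in> B \<Longrightarrow> block_vec b v = block_vec b w"
  shows "v = w"
proof (rule eq_vecI)
  fix p assume "p < dim_vec w"
  then have p: "p < N" using assms by simp
  have "block_vec (fst (\<sigma> p)) v $ snd (\<sigma> p) = block_vec (fst (\<sigma> p)) w $ snd (\<sigma> p)"
    using assms(3) sigma_mem(1)[OF p] by simp
  then show "v $ p = w $ p" using sigma_mem[OF p] by (simp add: block_vec_def pos_sigma[OF p])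
qed (use assms in simp)

lemma block_vec_glue:
  assumes "\<And>b. b \<in> B \<Longrightarrow> y b \<in> carrier_vec (d b)"
  obtains w where "w \<in> carrier_vec N" "\<And>b. b \<in> B \<Longrightarrow> block_vec b w = y b"
proof
  let ?w = "vec N (\<lambda>p. y (fst (\<sigma> p)) $ snd (\<sigma> p))"
  show "?w \<in> carrier_vec N" by simp
  show "block_vec b ?w = y b" if "b \<in> B" for b
    using assms[OF that] that by (intro eq_vecI) (auto simp: block_vec_def pos_less sigma_pos)
qed

end

section \<open>Smith groups of block-diagonal matrices\<close>

lemma row_lattice_subgroup:
  assumes M: "M \<in> carrier_mat m d"
  shows "subgroup (row_lattice M) (monoid_vec TYPE(int) d)"
proof -
  interpret V: comm_group "monoid_vec TYPE(int) d" by (rule comm_group_vec)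
  have T: "transpose_mat M \<in> carrier_mat d m" using M by simp
  have lat: "row_lattice M = {transpose_mat M *\<^sub>v c | c. c \<in> carrier_vec m}"
    using M unfolding row_lattice_def by auto
  show ?thesis
  proof (rule V.subgroupI)
    show "row_lattice M \<subseteq> carrier (monoid_vec TYPE(int) d)"
      using T unfolding lat monoid_vec_simps by auto
    show "row_lattice M \<noteq> {}" unfolding lat using zero_carrier_vec by blast
  next
    fix x assume "x \<in> row_lattice M"
    then obtain c where c: "c \<in> carrier_vec m" "x = transpose_mat M *\<^sub>v c" unfolding lat by blast
    have x: "x \<in> carrier_vec d" using T c by simp
    have "inv\<^bsub>monoid_vec TYPE(int) d\<^esub> x = (-1) \<cdot>\<^sub>v x"
      by (rule V.inv_equality) (use x in \<open>auto simp: monoid_vec_simps intro!: eq_vecI\<close>)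
    also have "\<dots> = transpose_mat M *\<^sub>v ((-1) \<cdot>\<^sub>v c)"
      unfolding c(2) using T c(1) by (intro eq_vecI) (auto simp: scalar_prod_def sum_negf[symmetric])
    finally have "inv\<^bsub>monoid_vec TYPE(int) d\<^esub> x = transpose_mat M *\<^sub>v ((-1) \<cdot>\<^sub>v c)" .
    moreover have "(-1) \<cdot>\<^sub>v c \<in> carrier_vec m" using c(1) by simp
    ultimately show "inv\<^bsub>monoid_vec TYPE(int) d\<^esub> x \<in> row_lattice M"
      unfolding lat by blast
  next
    fix x y assume "x \<in> row_lattice M" "y \<in> row_lattice M"
    then obtain c c' where "c \<in> carrier_vec m" "x = transpose_mat M *\<^sub>v c"
      "c' \<in> carrier_vec m" "y = transpose_mat M *\<^sub>v c'" unfolding lat by blast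
    then have "x + y = transpose_mat M *\<^sub>v (c + c')" "c + c' \<in> carrier_vec m"
      using mult_add_distrib_mat_vec[OF T] by auto
    then show "x \<otimes>\<^bsub>monoid_vec TYPE(int) d\<^esub> y \<in> row_lattice M"
      unfolding lat monoid_vec_simps by blast
  qed
qed

lemma row_lattice_normal:
  assumes "M \<in> carrier_mat m d"
  shows "row_lattice M \<lhd> monoid_vec TYPE(int) d"
  using comm_group.subgroup_imp_normal[OF comm_group_vec] row_lattice_subgroup[OF assms] .

lemma smith_group_eq:
  "M \<in> carrier_mat m d \<Longrightarrow> smith_group M = monoid_vec TYPE(int) d Mod row_lattice M"
  unfolding smith_group_def by auto

lemma group_smith_group: "group (smith_group M)"
proof -
  have "M \<in> carrier_mat (dim_row M) (dim_col M)" by simp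
  then show ?thesis unfolding smith_group_def
    using normal.factorgroup_is_group row_lattice_normal by blast
qed

lemma carrier_sum_group_finite:
  assumes "finite I" "\<And>i. i \<in> I \<Longrightarrow> group (G i)"
  shows "carrier (sum_group I G) = (\<Pi>\<^sub>E i\<in>I. carrier (G i))"
  using assms by (simp add: carrier_sum_group)

text \<open>The isomorphism is currying.\<close>

lemma sum_group_Sigma_iso:
  assumes "finite I" "\<And>i. i \<in> I \<Longrightarrow> finite (J i)"
    and G: "\<And>i j. i \<in> I \<Longrightarrow> j \<in> J i \<Longrightarrow> group (G i j)"
  shows "sum_group (Sigma I J) (\<lambda>(i, j). G i j) \<cong> sum_group I (\<lambda>i. sum_group (J i) (G i))"
proof -
  let ?S = "sum_group (Sigma I J) (\<lambda>(i, j). G i j)" and ?T = "sum_group I (\<lambda>i. sum_group (J i) (G i))"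
  let ?h = "\<lambda>f. \<lambda>i\<in>I. \<lambda>j\<in>J i. f (i, j)"
  have inner: "group (sum_group (J i) (G i))" if "i \<in> I" for i
    using G that by (intro sum_group) auto
  have cS: "carrier ?S = (\<Pi>\<^sub>E z\<in>Sigma I J. carrier (case z of (i, j) \<Rightarrow> G i j))"
    using assms by (intro carrier_sum_group_finite) auto
  have cT: "carrier ?T = (\<Pi>\<^sub>E i\<in>I. \<Pi>\<^sub>E j\<in>J i. carrier (G i j))"
    using assms inner by (simp add: carrier_sum_group_finite cong: PiE_cong)
  have "?h \<in> iso ?S ?T"
  proof (rule isoI)
    show "?h \<in> hom ?S ?T"
    proof (rule homI)
      fix f assume f: "f \<in> carrier ?S"
      show "?h f \<in> carrier ?T" unfolding cT
      proof (intro restrict_PiE_iff[THEN iffD2] ballI)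
        fix i j assume "i \<in> I" "j \<in> J i"
        then have "(i, j) \<in> Sigma I J" by simp
        with f show "f (i, j) \<in> carrier (G i j)" unfolding cS by (drule_tac PiE_mem) auto
      qed
    next
      fix f g assume "f \<in> carrier ?S" "g \<in> carrier ?S"
      show "?h (f \<otimes>\<^bsub>?S\<^esub> g) = ?h f \<otimes>\<^bsub>?T\<^esub> ?h g"
        unfolding mult_sum_group by (auto intro!: restrict_ext simp: restrict_def fun_eq_iff)
    qed
    show "bij_betw ?h (carrier ?S) (carrier ?T)"
    proof (rule bij_betw_byWitness[where f' = "\<lambda>g. \<lambda>z\<in>Sigma I J. g (fst z) (snd z)"])
      show "\<forall>f\<in>carrier ?S. (\<lambda>z\<in>Sigma I J. ?h f (fst z) (snd z)) = f"
        unfolding cS by (auto simp: fun_eq_iff restrict_def PiE_def extensional_def)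
      show "\<forall>g\<in>carrier ?T. ?h (\<lambda>z\<in>Sigma I J. g (fst z) (snd z)) = g"
      proof
        fix g assume g: "g \<in> carrier ?T"
        have "?h (\<lambda>z\<in>Sigma I J. g (fst z) (snd z)) i = g i" for i
        proof (cases "i \<in> I")
          case True
          then have "g i \<in> (\<Pi>\<^sub>E j\<in>J i. carrier (G i j))" using g unfolding cT by (rule_tac PiE_mem)
          then show ?thesis using True by (auto simp: fun_eq_iff restrict_def PiE_def extensional_def)
        next
          case False
          then show ?thesis using g unfolding cT by (auto simp: PiE_def extensional_def)
        qed
        then show "?h (\<lambda>z\<in>Sigma I J. g (fst z) (snd z)) = g" by (rule ext)
      qed
      show "?h ` carrier ?S \<subseteq> carrier ?T"
        using \<open>?h \<in> hom ?S ?T\<close> by (auto simp: hom_def Pi_iff)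
      show "(\<lambda>g. \<lambda>z\<in>Sigma I J. g (fst z) (snd z)) ` carrier ?T \<subseteq> carrier ?S"
        unfolding cS cT
      proof (intro image_subsetI restrict_PiE_iff[THEN iffD2] ballI)
        fix g z assume g: "g \<in> (\<Pi>\<^sub>E i\<in>I. \<Pi>\<^sub>E j\<in>J i. carrier (G i j))" and z: "z \<in> Sigma I J"
        then have "g (fst z) \<in> (\<Pi>\<^sub>E j\<in>J (fst z). carrier (G (fst z) j))" by auto
        then show "g (fst z) (snd z) \<in> carrier (case z of (i, j) \<Rightarrow> G i j)"
          using z by (auto simp: split_beta)
      qed
    qed
  qed
  then show ?thesis by (rule is_isoI)
qed

context block_indexing
begin

text \<open>Multiplication by the transpose of \<open>P\<close> is an automorphism of the group of integer vectors that carries the row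
lattice of \<open>L\<close> onto that of the block-diagonal matrix, which is the product of the row lattices of the
blocks. So cutting the image of a vector into blocks and reducing each modulo its row lattice is a
surjective homomorphism with kernel the row lattice of \<open>L\<close>.\<close>

lemma smith_group_block_similar:
  assumes L: "L \<in> carrier_mat N N" and P: "P \<in> carrier_mat N N" and Q: "Q \<in> carrier_mat N N"
    and PQ: "P * Q = 1\<^sub>m N" and QP: "Q * P = 1\<^sub>m N" and sim: "L * P = P * block_mat M"
    and M: "\<And>b. b \<in> B \<Longrightarrow> M b \<in> carrier_mat (d b) (d b)"
  shows "smith_group L \<cong> sum_group B (\<lambda>b. smith_group (M b))"
proof -
  let ?V = "\<lambda>m. monoid_vec TYPE(int) m" and ?S = "sum_group B (\<lambda>b. smith_group (M b))"
  let ?BM = "transpose_mat (block_mat M)" and ?P = "transpose_mat P" and ?Q = "transpose_mat Q"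
  let ?L = "transpose_mat L"
  define h where "h v = (\<lambda>b\<in>B. row_lattice (M b) #>\<^bsub>?V (d b)\<^esub> block_vec b (?P *\<^sub>v v))" for v
  have V: "group (?V m)" for m using comm_group_vec comm_group.axioms(2) by blast
  have S: "group ?S" by (rule sum_group) (rule group_smith_group)
  have cS: "carrier ?S = (\<Pi>\<^sub>E b\<in>B. carrier (smith_group (M b)))"
    using finite_B group_smith_group by (rule carrier_sum_group_finite)
  have coset_hom: "(\<lambda>a. row_lattice (M b) #>\<^bsub>?V (d b)\<^esub> a) \<in> hom (?V (d b)) (smith_group (M b))"
    if "b \<in> B" for b
    unfolding smith_group_eq[OF M[OF that]]
    by (rule normal.r_coset_hom_Mod[OF row_lattice_normal[OF M[OF that]]])
  have PT: "?P \<in> carrier_mat N N" "?Q \<in> carrier_mat N N" "?L \<in> carrier_mat N N" "?BM \<in> carrier_mat N N"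
    using P Q L by auto
  have "?P * ?Q = transpose_mat (Q * P)" "?Q * ?P = transpose_mat (P * Q)"
    using transpose_mult[OF Q P] transpose_mult[OF P Q] by auto
  then have inv: "?P * ?Q = 1\<^sub>m N" "?Q * ?P = 1\<^sub>m N" using PQ QP by auto
  have simT: "?P * ?L = ?BM * ?P"
    using transpose_mult[OF L P] transpose_mult[OF P block_mat_carrier[of M]] sim by simp
  have PQv: "?P *\<^sub>v (?Q *\<^sub>v w) = w" "?Q *\<^sub>v (?P *\<^sub>v w) = w" if "w \<in> carrier_vec N" for w
    using assoc_mult_mat_vec[OF PT(1,2) that] assoc_mult_mat_vec[OF PT(2,1) that] inv that by auto
  have Pv: "?P *\<^sub>v v \<in> carrier_vec N" if "v \<in> carrier_vec N" for v using PT(1) that by simp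
  have "h \<in> hom (?V N) ?S"
  proof (rule homI)
    fix v assume "v \<in> carrier (?V N)"
    show "h v \<in> carrier ?S"
      unfolding cS h_def
    proof (intro restrict_PiE_iff[THEN iffD2] ballI)
      fix b assume "b \<in> B"
      from hom_in_carrier[OF coset_hom[OF this], of "block_vec b (?P *\<^sub>v v)"]
      show "row_lattice (M b) #>\<^bsub>?V (d b)\<^esub> block_vec b (?P *\<^sub>v v) \<in> carrier (smith_group (M b))"
        by (simp add: monoid_vec_simps)
    qed
  next
    fix v w assume "v \<in> carrier (?V N)" "w \<in> carrier (?V N)"
    then have vw: "v \<in> carrier_vec N" "w \<in> carrier_vec N" by (simp_all add: monoid_vec_simps)
    have "row_lattice (M b) #>\<^bsub>?V (d b)\<^esub> block_vec b (?P *\<^sub>v (v + w))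
        = (row_lattice (M b) #>\<^bsub>?V (d b)\<^esub> block_vec b (?P *\<^sub>v v)) \<otimes>\<^bsub>smith_group (M b)\<^esub>
          (row_lattice (M b) #>\<^bsub>?V (d b)\<^esub> block_vec b (?P *\<^sub>v w))" if b: "b \<in> B" for b
    proof -
      have "block_vec b (?P *\<^sub>v (v + w)) = block_vec b (?P *\<^sub>v v) + block_vec b (?P *\<^sub>v w)"
        using block_vec_add[OF b Pv[OF vw(1)] Pv[OF vw(2)]] mult_add_distrib_mat_vec[OF PT(1) vw] by simp
      then show ?thesis
        using hom_mult[OF coset_hom[OF b], of "block_vec b (?P *\<^sub>v v)" "block_vec b (?P *\<^sub>v w)"]
        by (simp add: monoid_vec_simps)
    qed
    then show "h (v \<otimes>\<^bsub>?V N\<^esub> w) = h v \<otimes>\<^bsub>?S\<^esub> h w"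
      unfolding h_def mult_sum_group monoid_vec_simps by (intro restrict_ext) simp
  qed
  then interpret h: group_hom "?V N" ?S h
    using V S by (simp add: group_hom_def group_hom_axioms_def)
  have surj: "h ` carrier (?V N) = carrier ?S"
  proof
    show "h ` carrier (?V N) \<subseteq> carrier ?S" using h.hom_closed by blast
    show "carrier ?S \<subseteq> h ` carrier (?V N)"
    proof
      fix y assume y: "y \<in> carrier ?S"
      have "\<exists>a \<in> carrier_vec (d b). y b = row_lattice (M b) #>\<^bsub>?V (d b)\<^esub> a" if b: "b \<in> B" for b
      proof -
        have "y b \<in> carrier (smith_group (M b))" using y b unfolding cS by auto
        then show ?thesis
          unfolding smith_group_eq[OF M[OF b]] carrier_FactGroup by (auto simp: monoid_vec_simps)
      qed
      then obtain a where a: "\<And>b. b \<in> B \<Longrightarrow> a b \<in> carrier_vec (d b)"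
        "\<And>b. b \<in> B \<Longrightarrow> y b = row_lattice (M b) #>\<^bsub>?V (d b)\<^esub> a b" by metis
      obtain w where w: "w \<in> carrier_vec N" "\<And>b. b \<in> B \<Longrightarrow> block_vec b w = a b"
        using block_vec_glue[of a] a(1) by blast
      have "h (?Q *\<^sub>v w) = (\<lambda>b\<in>B. y b)"
        unfolding h_def PQv(1)[OF w(1)] by (intro restrict_ext) (simp add: w(2) a(2))
      also have "\<dots> = y" using y unfolding cS by (rule PiE_restrict)
      finally have "y = h (?Q *\<^sub>v w)" ..
      moreover have "?Q *\<^sub>v w \<in> carrier (?V N)" using PT(2) w(1) by (simp add: monoid_vec_simps)
      ultimately show "y \<in> h ` carrier (?V N)" by blast
    qed
  qed
  have coset_triv: "row_lattice (M b) #>\<^bsub>?V (d b)\<^esub> a = row_lattice (M b) \<longleftrightarrow> a \<in> row_lattice (M b)"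
    if "b \<in> B" "a \<in> carrier_vec (d b)" for a b
  proof -
    have a: "a \<in> carrier (?V (d b))" using that(2) by (simp add: monoid_vec_simps)
    note sub = row_lattice_subgroup[OF M[OF that(1)]]
    show ?thesis using group.coset_join1[OF V _ a sub] group.coset_join2[OF V a sub] by blast
  qed
  have one: "\<one>\<^bsub>?S\<^esub> = (\<lambda>b\<in>B. row_lattice (M b))"
    unfolding one_sum_group smith_group_def by simp
  have ker: "kernel (?V N) ?S h = row_lattice L"
  proof (intro equalityI subsetI)
    fix v assume "v \<in> kernel (?V N) ?S h"
    then have v: "v \<in> carrier_vec N" "h v = \<one>\<^bsub>?S\<^esub>" by (auto simp: kernel_def monoid_vec_simps)
    have "\<exists>c \<in> carrier_vec (d b). block_vec b (?P *\<^sub>v v) = transpose_mat (M b) *\<^sub>v c" if b: "b \<in> B" for b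
    proof -
      have "row_lattice (M b) #>\<^bsub>?V (d b)\<^esub> block_vec b (?P *\<^sub>v v) = row_lattice (M b)"
        using fun_cong[OF v(2), of b] b unfolding one h_def by simp
      then have "block_vec b (?P *\<^sub>v v) \<in> row_lattice (M b)" using coset_triv[OF b] by simp
      then show ?thesis using M[OF b] unfolding row_lattice_def by auto
    qed
    then obtain c where c: "\<And>b. b \<in> B \<Longrightarrow> c b \<in> carrier_vec (d b)"
      "\<And>b. b \<in> B \<Longrightarrow> block_vec b (?P *\<^sub>v v) = transpose_mat (M b) *\<^sub>v c b" by metis
    obtain w where w: "w \<in> carrier_vec N" "\<And>b. b \<in> B \<Longrightarrow> block_vec b w = c b"
      using block_vec_glue[of c] c(1) by blast
    have "?P *\<^sub>v v = ?BM *\<^sub>v w"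
    proof (rule block_vec_ext)
      show "block_vec b (?P *\<^sub>v v) = block_vec b (?BM *\<^sub>v w)" if b: "b \<in> B" for b
        using block_vec_transpose_mult[of b M w] b M w c by simp
      show "?P *\<^sub>v v \<in> carrier_vec N" by (rule Pv[OF v(1)])
      show "?BM *\<^sub>v w \<in> carrier_vec N" using PT(4) w(1) by (rule mult_mat_vec_carrier)
    qed
    also have "\<dots> = ?BM *\<^sub>v (?P *\<^sub>v (?Q *\<^sub>v w))" using PQv(1)[OF w(1)] by simp
    also have "\<dots> = ?P *\<^sub>v (?L *\<^sub>v (?Q *\<^sub>v w))"
    proof -
      have Qw: "?Q *\<^sub>v w \<in> carrier_vec N" using PT(2) w(1) by simp
      show ?thesis
        using assoc_mult_mat_vec[OF PT(4,1) Qw] assoc_mult_mat_vec[OF PT(1,3) Qw] simT by simp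
    qed
    finally have "?Q *\<^sub>v (?P *\<^sub>v v) = ?Q *\<^sub>v (?P *\<^sub>v (?L *\<^sub>v (?Q *\<^sub>v w)))" by simp
    then have "v = ?L *\<^sub>v (?Q *\<^sub>v w)" using PQv(2) v(1) PT w(1) by simp
    moreover have "?Q *\<^sub>v w \<in> carrier_vec (dim_row L)" using PT(2) w(1) L by simp
    ultimately show "v \<in> row_lattice L" unfolding row_lattice_def by blast
  next
    fix v assume "v \<in> row_lattice L"
    then obtain c where c: "c \<in> carrier_vec N" "v = ?L *\<^sub>v c" using L unfolding row_lattice_def by auto
    have v: "v \<in> carrier_vec N" using c PT(3) by simp
    have Pvc: "?P *\<^sub>v v = ?BM *\<^sub>v (?P *\<^sub>v c)"
      unfolding c(2) using assoc_mult_mat_vec[OF PT(4,1) c(1)] assoc_mult_mat_vec[OF PT(1,3) c(1)] simT by simp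
    have "h v = \<one>\<^bsub>?S\<^esub>"
      unfolding h_def one
    proof (rule restrict_ext)
      fix b assume b: "b \<in> B"
      have "block_vec b (?P *\<^sub>v v) = transpose_mat (M b) *\<^sub>v block_vec b (?P *\<^sub>v c)"
        unfolding Pvc using b M[OF b] Pv[OF c(1)] by (rule block_vec_transpose_mult)
      then have "block_vec b (?P *\<^sub>v v) \<in> row_lattice (M b)"
        using M[OF b] unfolding row_lattice_def by auto
      then show "row_lattice (M b) #>\<^bsub>?V (d b)\<^esub> block_vec b (?P *\<^sub>v v) = row_lattice (M b)"
        using coset_triv[OF b] by simp
    qed
    then show "v \<in> kernel (?V N) ?S h" using v by (simp add: kernel_def monoid_vec_simps)
  qed
  show ?thesis
    using h.FactGroup_iso[OF surj] unfolding ker smith_group_eq[OF L] .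
qed

end

section \<open>Multiplicities and the change of basis\<close>

lemma card_ballot_layer:
  assumes "2 * i \<le> n + 1"
  shows "int (card {J \<in> ballot n 0. card J = i}) = int (n choose i) - (if i = 0 then 0 else int (n choose (i - 1)))"
  using ballot_card[of i n 0] assms by (cases i) auto

lemma sum_card_ballot_layers:
  assumes "2 * m \<le> n + 1"
  shows "(\<Sum>i\<le>m. card {J \<in> ballot n 0. card J = i}) = n choose m"
proof -
  have "(\<Sum>i\<le>m. int (card {J \<in> ballot n 0. card J = i})) = int (n choose m)"
    using assms
  proof (induction m)
    case 0
    then show ?case using card_ballot_layer[of 0 n] by simp
  next
    case (Suc m)
    then show ?case using card_ballot_layer[of "Suc m" n] by simp
  qed
  then show ?thesis unfolding of_nat_sum[symmetric] of_nat_eq_iff .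
qed

lemma M_mult_nat:
  "M_mult n 0 = 1" "M_mult n (Suc 0) = int (n choose 1) - 2"
  "M_mult n (Suc (Suc s)) = int (n choose Suc (Suc s)) - 2 * int (n choose Suc s) + int (n choose s)"
proof -
  show "M_mult n 0 = 1" using ibinom_nat[of n 0] by (simp add: M_mult_def) (simp add: ibinom_def)
  show "M_mult n (Suc 0) = int (n choose 1) - 2"
    using ibinom_nat[of n 1] ibinom_nat[of n 0] by (simp add: M_mult_def) (simp add: ibinom_def)
  have "int (Suc (Suc s)) - 1 = int (Suc s)" "int (Suc (Suc s)) - 2 = int s" by simp_all
  then show "M_mult n (Suc (Suc s)) = int (n choose Suc (Suc s)) - 2 * int (n choose Suc s) + int (n choose s)"
    unfolding M_mult_def by (simp only: ibinom_nat)
qed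

text \<open>The chains present at level \<open>i\<close> form a basis of the functions on ballot \<open>i\<close>-sets, so the number of chains
starting at \<open>s\<close> is the difference of the numbers of ballot sets of sizes \<open>s\<close> and \<open>s - 1\<close>.\<close>

lemma binomial_chains_multiplicity:
  assumes k: "3 * k \<le> n + 1"
  shows "\<exists>x. binomial_chains n k (\<lambda>s. nat (M_mult n s)) x"
proof -
  obtain r x where ch: "binomial_chains n k r x" using binomial_chains_exist[OF k] by blast
  have partial: "(\<Sum>s\<le>i. int (r s)) = int (n choose i) - (if i = 0 then 0 else int (n choose (i - 1)))"
    if "i \<le> k" for i
  proof -
    have "2 * i \<le> n + 1" using that k by linarith
    then show ?thesis
      unfolding of_nat_sum[symmetric] binomial_chains_card[OF ch that] by (rule card_ballot_layer)
  qed
  have mult: "int (r s) = M_mult n s" if s: "s \<le> k" for s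
  proof -
    consider "s = 0" | "s = Suc 0" | t where "s = Suc (Suc t)" by (metis not0_implies_Suc)
    then show ?thesis
    proof cases
      case 1
      then show ?thesis using partial[of 0] by (simp add: M_mult_nat)
    next
      case 2
      then show ?thesis using partial[of 0] partial[of "Suc 0"] s by (simp add: M_mult_nat)
    next
      case 3
      then show ?thesis using partial[of "Suc t"] partial[of "Suc (Suc t)"] s by (simp add: M_mult_nat)
    qed
  qed
  have "blocks (\<lambda>s. nat (M_mult n s)) i = blocks r i" if "i \<le> k" for i
    unfolding blocks_def using that mult by (intro Sigma_cong) (auto simp flip: mult)
  then show ?thesis using ch unfolding binomial_chains_def by (intro exI[of _ x]) simp
qed

text \<open>Interpolate \<open>f\<close> on ballot sets and expand each homogeneous part in the chains; parts of degree above \<open>k\<close> do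
not contribute on \<open>k\<close>-sets.\<close>

lemma binomial_chains_span:
  assumes ch: "binomial_chains n k r x"
  shows "\<exists>c. \<forall>K \<subseteq> {1..n}. card K = k \<longrightarrow>
    f K = (\<Sum>b\<in>blocks r k. \<Sum>i\<in>{fst b..k}. c b i * downsum (x b i) K)"
proof -
  obtain g where g: "\<And>J. g J \<noteq> 0 \<Longrightarrow> J \<in> ballot n 0"
    "\<And>K. K \<subseteq> {1..n} \<Longrightarrow> card K = k \<Longrightarrow> downsum g K = f K"
    using ballot_interpolation[of n 0 k f] by (metis add_0_right order_refl)
  define h where "h i J = (if card J = i then g J else 0)" for i J
  have h: "h i \<in> layer (ballot n 0) i" for i using g(1) by (auto simp: h_def layer_def)
  have "\<exists>c. h i = (\<lambda>a. \<Sum>b\<in>blocks r i. c b * x b i a)" if "i \<le> k" for i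
    using ch that h zbasis_span[of "blocks r i" "\<lambda>b. x b i"] unfolding binomial_chains_def by blast
  then obtain c where c: "\<And>i. i \<le> k \<Longrightarrow> h i = (\<lambda>a. \<Sum>b\<in>blocks r i. c i b * x b i a)" by metis
  have "f K = (\<Sum>b\<in>blocks r k. \<Sum>i\<in>{fst b..k}. c i b * downsum (x b i) K)"
    if K: "K \<subseteq> {1..n}" "card K = k" for K
  proof -
    have finK: "finite K" using K finite_subset by blast
    have "f K = (\<Sum>J\<in>Pow K. g J)" using g(2)[OF K] by (simp add: downsum_def)
    also have "\<dots> = (\<Sum>J\<in>Pow K. \<Sum>i\<le>k. h i J)"
    proof (rule sum.cong[OF refl])
      fix J assume "J \<in> Pow K"
      then have "card J \<le> k" using K(2) finK card_mono by blast
      then show "g J = (\<Sum>i\<le>k. h i J)" by (simp add: h_def)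
    qed
    also have "\<dots> = (\<Sum>i\<le>k. \<Sum>J\<in>Pow K. h i J)" by (rule sum.swap)
    also have "\<dots> = (\<Sum>i\<le>k. \<Sum>b | b \<in> blocks r k \<and> fst b \<le> i. c i b * downsum (x b i) K)"
    proof (rule sum.cong[OF refl])
      fix i assume "i \<in> {..k}"
      then have i: "i \<le> k" by simp
      have "(\<Sum>J\<in>Pow K. h i J) = (\<Sum>b\<in>blocks r i. \<Sum>J\<in>Pow K. c i b * x b i J)"
        unfolding c[OF i] by (rule sum.swap)
      then show "(\<Sum>J\<in>Pow K. h i J) = (\<Sum>b | b \<in> blocks r k \<and> fst b \<le> i. c i b * downsum (x b i) K)"
        unfolding blocks_le[OF i] downsum_def sum_distrib_left .
    qed
    also have "\<dots> = (\<Sum>b\<in>blocks r k. \<Sum>i | i \<in> {..k} \<and> fst b \<le> i. c i b * downsum (x b i) K)"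
      by (rule sum.swap_restrict) auto
    also have "\<dots> = (\<Sum>b\<in>blocks r k. \<Sum>i\<in>{fst b..k}. c i b * downsum (x b i) K)"
      by (intro sum.cong refl) auto
    finally show ?thesis .
  qed
  then show ?thesis by (intro exI[of _ "\<lambda>b i. c i b"]) blast
qed

text \<open>Counted by level instead of by chain, these are the ballot sets of sizes \<open>0, \<dots>, k\<close>, whose numbers telescope.\<close>

lemma card_chain_vectors:
  assumes ch: "binomial_chains n k r x" and k: "2 * k \<le> n + 1"
  shows "card (SIGMA b:blocks r k. {..<k - fst b + 1}) = n choose k"
proof -
  have "card (SIGMA b:blocks r k. {..<k - fst b + 1}) = card (SIGMA i:{..k}. blocks r i)"
    by (rule bij_betw_same_card[of "\<lambda>(b, a). (fst b + a, b)"],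
        rule bij_betw_byWitness[where f' = "\<lambda>(i, b). (b, i - fst b)"])
      (auto simp: blocks_def)
  also have "\<dots> = (\<Sum>i\<le>k. card (blocks r i))" by simp
  also have "\<dots> = (\<Sum>i\<le>k. card {J \<in> ballot n 0. card J = i})"
    using binomial_chains_card[OF ch] by (intro sum.cong) (auto simp: blocks_def)
  also have "\<dots> = n choose k" by (rule sum_card_ballot_layers[OF k])
  finally show ?thesis .
qed

lemma sum_repeat_mset: "(\<Sum>q<m. X) = repeat_mset m X"
  by (induction m) (auto simp: add.commute)

theorem theorem4p4:
  fixes n k l :: nat and lam :: int
    and e :: "nat \<Rightarrow> nat set" and L :: "int mat"
  assumes "l \<le> k" and "k \<le> n" and "int n \<ge> 3 * int k - 1"
    and "bij_betw e {..<n choose k} (k_subsets n k)"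
    and "L = subset_adj_mat e n k l - lam \<cdot>\<^sub>m 1\<^sub>m (n choose k)"
  shows "(\<forall>\<Delta> :: nat \<Rightarrow> int multiset.
            (\<forall>s \<in> {0..k}. \<exists>D. is_diagonal_form (M_mat n k l lam s) D \<and> \<Delta> s = diag_entries D) \<longrightarrow>
            (\<exists>D. is_diagonal_form L D \<and>
                 diag_entries D = (\<Sum>s = 0..k. repeat_mset (nat (M_mult n s)) (\<Delta> s))))
       \<and> smith_group L \<cong>
           sum_group {0..k} (\<lambda>s. group_power (smith_group (M_mat n k l lam s)) (nat (M_mult n s)))"
proof -
  define N where "N = n choose k"
  define r where "r s = nat (M_mult n s)" for s
  define B where "B = (SIGMA s:{0..k}. {..<r s})"
  define d where "d b = k - fst b + 1" for b :: "nat \<times> nat"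
  define M where "M b = M_mat n k l lam (fst b)" for b :: "nat \<times> nat"
  have k3: "3 * k \<le> n + 1" using assms(3) by linarith
  obtain x where ch: "binomial_chains n k r x"
    using binomial_chains_multiplicity[OF k3] unfolding r_def by blast
  have B_blocks: "B = blocks r k" by (simp add: B_def blocks_def atMost_atLeast0)
  have "2 * k \<le> n + 1" using k3 by linarith
  then have "card (SIGMA b:B. {..<d b}) = N"
    unfolding B_blocks d_def N_def by (rule card_chain_vectors[OF ch])
  moreover have "finite (SIGMA b:B. {..<d b})" unfolding B_blocks by auto
  ultimately obtain \<sigma> where \<sigma>: "bij_betw \<sigma> {..<N} (SIGMA b:B. {..<d b})"
    using ex_bij_betw_nat_finite[of "SIGMA b:B. {..<d b}"] by (auto simp: atLeast0LessThan)
  interpret block_indexing N B d \<sigma>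
    by unfold_locales (use \<sigma> in \<open>auto simp: B_blocks\<close>)
  have e: "bij_betw e {..<N} {K. K \<subseteq> {1..n} \<and> card K = k}"
    using assms(4) unfolding N_def k_subsets_def .
  have eK: "e a \<subseteq> {1..n}" "card (e a) = k" if "a < N" for a
    using e that by (auto simp: bij_betw_def)
  have L: "L \<in> carrier_mat N N" unfolding assms(5) subset_adj_mat_def N_def
    by (intro minus_carrier_mat) simp
  have M: "M b \<in> carrier_mat (d b) (d b)" for b by (simp add: M_def d_def M_mat_def)
  \<comment> \<open>The columns of \<open>P\<close> are the functions on \<open>k\<close>-sets induced by the members of the chains. The columns of \<open>Q\<close>
    hold the coordinates of the indicator functions of the single \<open>k\<close>-sets.\<close>
  define P where "P = mat N N (\<lambda>(a, p). downsum (x (fst (\<sigma> p)) (fst (fst (\<sigma> p)) + snd (\<sigma> p))) (e a))"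
  have P: "P \<in> carrier_mat N N" by (simp add: P_def)
  have P_pos: "P $$ (a, pos b i) = downsum (x b (fst b + i)) (e a)" if "a < N" "b \<in> B" "i < d b" for a b i
    using that by (simp add: P_def pos_less sigma_pos)
  have shift: "(\<Sum>i<d b. f (fst b + i)) = (\<Sum>i\<in>{fst b..k}. f i)" if "b \<in> B" for b and f :: "nat \<Rightarrow> int"
    by (rule sum.reindex_bij_witness[where i = "\<lambda>i. i - fst b" and j = "\<lambda>i. fst b + i"])
      (use that in \<open>auto simp: B_def d_def\<close>)
  have "\<forall>a. \<exists>c. \<forall>K \<subseteq> {1..n}. card K = k \<longrightarrow>
      (if K = e a then 1 else 0) = (\<Sum>b\<in>B. \<Sum>i\<in>{fst b..k}. c b i * downsum (x b i) K)"
    unfolding B_blocks by (intro allI) (rule binomial_chains_span[OF ch])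
  from choice[OF this] obtain c where c_all: "\<forall>a. \<forall>K \<subseteq> {1..n}. card K = k \<longrightarrow>
      (if K = e a then 1 else 0) = (\<Sum>b\<in>B. \<Sum>i\<in>{fst b..k}. c a b i * downsum (x b i) K)"
    by (rule exE)
  have c: "(if K = e a then 1 else 0) = (\<Sum>b\<in>B. \<Sum>i\<in>{fst b..k}. c a b i * downsum (x b i) K)"
    if "K \<subseteq> {1..n}" "card K = k" for a K
    using c_all[rule_format, OF that] .
  define Q where "Q = mat N N (\<lambda>(p, a). c a (fst (\<sigma> p)) (fst (fst (\<sigma> p)) + snd (\<sigma> p)))"
  have Q: "Q \<in> carrier_mat N N" by (simp add: Q_def)
  have Q_pos: "Q $$ (pos b i, a) = c a b (fst b + i)" if "a < N" "b \<in> B" "i < d b" for a b i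
    using that by (simp add: Q_def pos_less sigma_pos)
  have PQ: "P * Q = 1\<^sub>m N"
  proof (rule eq_matI)
    fix a a' assume "a < dim_row (1\<^sub>m N :: int mat)" "a' < dim_col (1\<^sub>m N :: int mat)"
    then have a: "a < N" "a' < N" by auto
    have "(P * Q) $$ (a, a') = (\<Sum>p<N. P $$ (a, p) * Q $$ (p, a'))"
      by (rule mult_index[OF P Q a])
    also have "\<dots> = (\<Sum>b\<in>B. \<Sum>i<d b. c a' b (fst b + i) * downsum (x b (fst b + i)) (e a))"
      unfolding sum_positions by (intro sum.cong refl) (simp add: P_pos Q_pos a)
    also have "\<dots> = (\<Sum>b\<in>B. \<Sum>i\<in>{fst b..k}. c a' b i * downsum (x b i) (e a))"
      by (rule sum.cong[OF refl]) (rule shift)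
    also have "\<dots> = (if e a = e a' then 1 else 0)" using c[OF eK[OF a(1)]] by simp
    also have "\<dots> = 1\<^sub>m N $$ (a, a')"
      using e a by (auto simp: bij_betw_def inj_on_def)
    finally show "(P * Q) $$ (a, a') = 1\<^sub>m N $$ (a, a')" .
  qed (use P Q in auto)
  have QP: "Q * P = 1\<^sub>m N" by (rule int_mat_right_inverse_imp_left_inverse[OF P Q PQ])
  have sim: "L * P = P * block_mat M"
  proof (rule eq_matI)
    fix a p assume "a < dim_row (P * block_mat M)" "p < dim_col (P * block_mat M)"
    then have a: "a < N" and p: "p < N" using P by auto
    define b i where "b = fst (\<sigma> p)" and "i = snd (\<sigma> p)"
    have bi: "b \<in> B" "i < d b" using sigma_mem[OF p] by (auto simp: b_def i_def)
    have p_eq: "p = pos b i" using pos_sigma[OF p] by (simp add: b_def i_def)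
    define u where "u = fst b + i"
    have u: "u \<le> k" "b \<in> blocks r u" using bi by (auto simp: u_def B_def d_def blocks_def)
    have L_index: "L $$ (a, a') = (if card (e a \<inter> e a') = l then 1 else 0) - (if a' = a then lam else 0)"
      if "a' < N" for a'
      using that a unfolding assms(5) subset_adj_mat_def N_def by auto
    have "(L * P) $$ (a, p) = (\<Sum>a'<N. L $$ (a, a') * P $$ (a', p))"
      by (rule mult_index[OF L P a p])
    also have "\<dots> = (\<Sum>a'<N. (if card (e a \<inter> e a') = l then 1 else 0) * downsum (x b u) (e a')
        - (if a' = a then lam * downsum (x b u) (e a') else 0))"
      by (intro sum.cong refl) (simp add: L_index p_eq P_pos bi u_def left_diff_distrib)
    also have "\<dots> = (\<Sum>a'<N. (if card (e a \<inter> e a') = l then 1 else 0) * downsum (x b u) (e a'))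
        - lam * downsum (x b u) (e a)"
      unfolding sum_subtractf using a by simp
    also have "(\<Sum>a'<N. (if card (e a \<inter> e a') = l then 1 else 0) * downsum (x b u) (e a'))
        = (\<Sum>K' | K' \<subseteq> {1..n} \<and> card K' = k. (if card (e a \<inter> K') = l then 1 else 0) * downsum (x b u) K')"
      by (rule sum.reindex_bij_betw[OF e])
    also have "\<dots> - lam * downsum (x b u) (e a)
        = (\<Sum>v\<in>{fst b..k}. M_entry n k l lam (fst b) v u * downsum (x b v) (e a))"
      by (rule binomial_chain_action[OF ch u(2,1) eK[OF a] assms(1)])
    also have "\<dots> = (\<Sum>i'<d b. M_entry n k l lam (fst b) (fst b + i') u * downsum (x b (fst b + i')) (e a))"
      by (rule shift[OF bi(1), symmetric])
    also have "\<dots> = (\<Sum>i'<d b. P $$ (a, pos b i') * M b $$ (i', i))"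
    proof (rule sum.cong[OF refl])
      fix i' assume "i' \<in> {..<d b}"
      then have i': "i' < d b" by simp
      have "M b $$ (i', i) = M_entry n k l lam (fst b) (fst b + i') u"
        using i' bi(2) by (simp add: M_def M_mat_def d_def u_def)
      then show "M_entry n k l lam (fst b) (fst b + i') u * downsum (x b (fst b + i')) (e a)
          = P $$ (a, pos b i') * M b $$ (i', i)"
        using P_pos[OF a bi(1) i'] by simp
    qed
    also have "\<dots> = (\<Sum>q<N. if fst (\<sigma> q) = b then P $$ (a, q) * M b $$ (snd (\<sigma> q), i) else 0)"
      unfolding sum_one_block[OF bi(1)] using bi(1) by (intro sum.cong refl) (simp add: sigma_pos)
    also have "\<dots> = (\<Sum>q<N. P $$ (a, q) * block_mat M $$ (q, p))"
      using p by (intro sum.cong refl) (simp add: block_mat_def b_def i_def)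
    also have "\<dots> = (P * block_mat M) $$ (a, p)"
      by (rule mult_index[OF P block_mat_carrier a p, symmetric])
    finally show "(L * P) $$ (a, p) = (P * block_mat M) $$ (a, p)" .
  qed (use P L in auto)
  show ?thesis
  proof (intro conjI allI impI)
    fix \<Delta> :: "nat \<Rightarrow> int multiset"
    assume "\<forall>s\<in>{0..k}. \<exists>D. is_diagonal_form (M_mat n k l lam s) D \<and> \<Delta> s = diag_entries D"
    then obtain D where D: "\<And>s. s \<le> k \<Longrightarrow> is_diagonal_form (M_mat n k l lam s) (D s)"
      "\<And>s. s \<le> k \<Longrightarrow> \<Delta> s = diag_entries (D s)" by (metis atLeastAtMost_iff zero_le)
    have Db: "is_diagonal_form (M b) (D (fst b))" if "b \<in> B" for b
      using that D(1)[of "fst b"] by (auto simp: B_def M_def)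
    have "is_diagonal_form L (block_mat (\<lambda>b. D (fst b)))"
      by (rule is_diagonal_form_block_similar[OF L P Q PQ QP sim M Db])
    moreover have "diag_entries (block_mat (\<lambda>b. D (fst b))) = (\<Sum>s = 0..k. repeat_mset (nat (M_mult n s)) (\<Delta> s))"
    proof -
      have "D (fst b) \<in> carrier_mat (d b) (d b)" if "b \<in> B" for b
        using Db[OF that] carrier_matD[OF M[of b]] unfolding is_diagonal_form_def by simp
      then have "diag_entries (block_mat (\<lambda>b. D (fst b))) = (\<Sum>b\<in>B. diag_entries (D (fst b)))"
        by (rule diag_entries_block_mat)
      also have "\<dots> = (\<Sum>s = 0..k. \<Sum>q<r s. diag_entries (D s))"
        unfolding B_def by (subst sum.Sigma) (auto simp: split_beta)
      also have "\<dots> = (\<Sum>s = 0..k. repeat_mset (nat (M_mult n s)) (\<Delta> s))"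
        by (intro sum.cong refl) (simp add: sum_repeat_mset r_def D(2))
      finally show ?thesis .
    qed
    ultimately show "\<exists>D. is_diagonal_form L D \<and>
        diag_entries D = (\<Sum>s = 0..k. repeat_mset (nat (M_mult n s)) (\<Delta> s))" by blast
  next
    have "smith_group L \<cong> sum_group B (\<lambda>b. smith_group (M b))"
      by (rule smith_group_block_similar[OF L P Q PQ QP sim M])
    moreover have "(\<lambda>b. smith_group (M b)) = (\<lambda>(s, q). smith_group (M_mat n k l lam s))"
      by (rule ext) (simp add: M_def case_prod_beta)
    moreover have "sum_group B (\<lambda>(s, q). smith_group (M_mat n k l lam s))
        \<cong> sum_group {0..k} (\<lambda>s. sum_group {..<r s} (\<lambda>_. smith_group (M_mat n k l lam s)))"
      unfolding B_def by (rule sum_group_Sigma_iso) (auto intro: group_smith_group)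
    ultimately show "smith_group L \<cong>
        sum_group {0..k} (\<lambda>s. group_power (smith_group (M_mat n k l lam s)) (nat (M_mult n s)))"
      unfolding group_power_def r_def[symmetric] by (simp only: iso_trans)
  qed
qed

end
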